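(* Let $X$ be an infinite-dimensional complex Banach space such that $\mathcal{K}(X^* )$ is amenable and $\mathcal{K}(X)$ has a bounded two-sided approximate identity. Then $\mathcal{K}(X)$ is amenable.
   Context: For a Banach space $Z$, $\mathcal{K}(Z)$ is the Banach algebra of compact operators on $Z$ with the operator norm. A Banach algebra $\mathcal{A}$ is amenable if for every Banach $\mathcal{A}$-bimodule $Z$, every continuous derivation $D:\mathcal{A}\to Z^*$ is inner, i.e. of the form $a\mapsto a\cdot z^*-z^*\cdot a$ for some $z^*\in Z^*$. Here $Z^*$ carries the dual module actions $\langle a\cdot z^*,z\rangle=\langle z^*,z\cdot a\rangle$, $\langle z^*\cdot a,z\rangle=\langle z^*,a\cdot z\rangle$, and a derivation is a linear map with $D(ab)=a\cdot D(b)+D(a)\cdot b$. A bounded two-sided approximate identity of a Banach algebra $\mathcal{A}$ is a norm-bounded net $(e_\beta)$ in $\mathcal{A}$ with $e_\beta a\to a$ and $ae_\beta\to a$ for all $a\in\mathcal{A}$. *)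

theory Defs
  imports "HOL-Analysis.Analysis"
begin

section \<open>Complex Banach spaces and Banach algebras as type classes\<close>

class scaleC =
  fixes scaleC :: "complex \<Rightarrow> 'a \<Rightarrow> 'a"  (infixr "*\<^sub>C" 75)

class complex_banach = banach + scaleC +
  assumes scaleC_add_right: "c *\<^sub>C (x + y) = c *\<^sub>C x + c *\<^sub>C y"
    and scaleC_add_left: "(c + d) *\<^sub>C x = c *\<^sub>C x + d *\<^sub>C x"
    and scaleC_scaleC: "c *\<^sub>C d *\<^sub>C x = (c * d) *\<^sub>C x"
    and scaleR_scaleC: "r *\<^sub>R x = complex_of_real r *\<^sub>C x"
    and norm_scaleC: "norm (c *\<^sub>C x) = cmod c * norm x"

text \<open>Banach algebras are complex and not assumed to have a unit.\<close>

class complex_banach_algebra = complex_banach + real_normed_algebra +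
  assumes mult_scaleC_left: "(c *\<^sub>C x) * y = c *\<^sub>C (x * y)"
    and mult_scaleC_right: "x * (c *\<^sub>C y) = c *\<^sub>C (x * y)"

lemma scaleC_one: "1 *\<^sub>C x = (x :: 'a::complex_banach)"
  using scaleR_scaleC[of 1 x] by simp

global_interpretation complex_vector: vector_space "scaleC :: complex \<Rightarrow> 'a \<Rightarrow> 'a::complex_banach"
  by unfold_locales (simp_all add: scaleC_add_right scaleC_add_left scaleC_scaleC scaleC_one)

definition infinite_dimensional :: "'a::complex_banach itself \<Rightarrow> bool" where
  "infinite_dimensional _ \<longleftrightarrow> \<not> (\<exists>B :: 'a set. finite B \<and> complex_vector.span B = UNIV)"

instantiation complex :: complex_banach
begin
definition scaleC_complex :: "complex \<Rightarrow> complex \<Rightarrow> complex" where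
  "scaleC_complex c z = c * z"
instance
  by standard (simp_all add: scaleC_complex_def algebra_simps norm_mult scaleR_conv_of_real)
end

lemma scaleC_minus_right: "c *\<^sub>C (- x) = - (c *\<^sub>C (x :: 'a::complex_banach))"
  by (rule complex_vector.scale_minus_right)

lemma scaleC_scaleR_commute: "c *\<^sub>C r *\<^sub>R x = r *\<^sub>R c *\<^sub>C (x :: 'a::complex_banach)"
  by (simp add: scaleR_scaleC scaleC_scaleC mult.commute)

lemma bounded_linear_scaleC: "bounded_linear (\<lambda>x :: 'a::complex_banach. c *\<^sub>C x)"
  by (rule bounded_linear_intro[of _ "cmod c"])
     (simp_all add: scaleC_add_right scaleC_scaleR_commute norm_scaleC)


section \<open>Bounded complex-linear operators, the dual space\<close>

typedef (overloaded) ('a::complex_banach, 'b::complex_banach) cblinfun =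
  "{f :: 'a \<Rightarrow>\<^sub>L 'b. \<forall>c x. f (c *\<^sub>C x) = c *\<^sub>C f x}"
  by (rule exI[of _ 0]) simp

setup_lifting type_definition_cblinfun

lift_definition cblinfun_apply :: "('a::complex_banach, 'b::complex_banach) cblinfun \<Rightarrow> 'a \<Rightarrow> 'b"
  is blinfun_apply .

lift_definition cblinfun_compose ::
  "('b::complex_banach, 'c::complex_banach) cblinfun \<Rightarrow> ('a::complex_banach, 'b) cblinfun
    \<Rightarrow> ('a, 'c) cblinfun" is blinfun_compose
  by simp

lift_definition scaleC_blinfun ::
  "complex \<Rightarrow> ('a::complex_banach \<Rightarrow>\<^sub>L 'b::complex_banach) \<Rightarrow> ('a \<Rightarrow>\<^sub>L 'b)"
  is "\<lambda>c f x. c *\<^sub>C f x"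
  by (rule bounded_linear_compose[OF bounded_linear_scaleC])

lemma norm_scaleC_blinfun_le: "norm (scaleC_blinfun c f) \<le> cmod c * norm f"
  by (rule norm_blinfun_bound)
     (simp_all add: scaleC_blinfun.rep_eq norm_scaleC mult.assoc mult_left_mono norm_blinfun)

lemma norm_scaleC_blinfun: "norm (scaleC_blinfun c f) = cmod c * norm f"
proof (cases "c = 0")
  case True
  then show ?thesis using norm_scaleC_blinfun_le[of c f] by simp
next
  case False
  have "scaleC_blinfun (inverse c) (scaleC_blinfun c f) = f"
    using False by (intro blinfun_eqI) (simp add: scaleC_blinfun.rep_eq)
  then have "norm f \<le> cmod (inverse c) * norm (scaleC_blinfun c f)"
    by (metis norm_scaleC_blinfun_le)
  then have "cmod c * norm f \<le> norm (scaleC_blinfun c f)"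
    using False by (simp add: norm_divide field_simps)
  then show ?thesis using norm_scaleC_blinfun_le[of c f] by simp
qed

instantiation cblinfun :: (complex_banach, complex_banach) real_normed_vector
begin

lift_definition zero_cblinfun :: "('a, 'b) cblinfun" is 0 by simp
lift_definition plus_cblinfun :: "('a, 'b) cblinfun \<Rightarrow> ('a, 'b) cblinfun \<Rightarrow> ('a, 'b) cblinfun"
  is "(+)" by (simp add: blinfun.add_left scaleC_add_right)
lift_definition minus_cblinfun :: "('a, 'b) cblinfun \<Rightarrow> ('a, 'b) cblinfun \<Rightarrow> ('a, 'b) cblinfun"
  is "(-)" by (simp add: blinfun.diff_left complex_vector.scale_right_diff_distrib)
lift_definition uminus_cblinfun :: "('a, 'b) cblinfun \<Rightarrow> ('a, 'b) cblinfun"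
  is uminus by (simp add: blinfun.minus_left scaleC_minus_right)
lift_definition scaleR_cblinfun :: "real \<Rightarrow> ('a, 'b) cblinfun \<Rightarrow> ('a, 'b) cblinfun"
  is "(*\<^sub>R)" by (simp add: blinfun.scaleR_left scaleC_scaleR_commute)
lift_definition norm_cblinfun :: "('a, 'b) cblinfun \<Rightarrow> real" is norm .

definition sgn_cblinfun :: "('a, 'b) cblinfun \<Rightarrow> ('a, 'b) cblinfun" where
  "sgn_cblinfun f = inverse (norm f) *\<^sub>R f"
definition dist_cblinfun :: "('a, 'b) cblinfun \<Rightarrow> ('a, 'b) cblinfun \<Rightarrow> real" where
  "dist_cblinfun f g = norm (f - g)"
definition uniformity_cblinfun :: "(('a, 'b) cblinfun \<times> ('a, 'b) cblinfun) filter" where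
  "uniformity_cblinfun = (INF e\<in>{0<..}. principal {(f, g). dist f g < e})"
definition open_cblinfun :: "('a, 'b) cblinfun set \<Rightarrow> bool" where
  "open_cblinfun U \<longleftrightarrow> (\<forall>f\<in>U. \<forall>\<^sub>F (f', g) in uniformity. f' = f \<longrightarrow> g \<in> U)"

instance
  by standard
     (rule sgn_cblinfun_def dist_cblinfun_def uniformity_cblinfun_def open_cblinfun_def
      | (transfer, simp add: algebra_simps norm_triangle_ineq; fail))+

end

instance cblinfun :: (complex_banach, complex_banach) banach
proof
  fix X :: "nat \<Rightarrow> ('a::complex_banach, 'b::complex_banach) cblinfun"
  assume "Cauchy X"
  then have "Cauchy (\<lambda>n. Rep_cblinfun (X n))"
    unfolding Cauchy_def dist_cblinfun_def
    by (simp add: dist_norm norm_cblinfun.rep_eq minus_cblinfun.rep_eq)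
  then obtain L where L: "(\<lambda>n. Rep_cblinfun (X n)) \<longlonglongrightarrow> L"
    using Cauchy_convergent_iff convergent_def by blast
  have "L (c *\<^sub>C x) = c *\<^sub>C L x" for c x
  proof -
    have "(\<lambda>n. Rep_cblinfun (X n) (c *\<^sub>C x)) \<longlonglongrightarrow> L (c *\<^sub>C x)"
      by (intro tendsto_intros L)
    moreover have "(\<lambda>n. Rep_cblinfun (X n) (c *\<^sub>C x)) = (\<lambda>n. c *\<^sub>C Rep_cblinfun (X n) x)"
      using Rep_cblinfun by auto
    moreover have "(\<lambda>n. c *\<^sub>C Rep_cblinfun (X n) x) \<longlonglongrightarrow> c *\<^sub>C L x"
      by (intro bounded_linear.tendsto[OF bounded_linear_scaleC] tendsto_intros L)
    ultimately show ?thesis using LIMSEQ_unique by metis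
  qed
  then obtain f where f: "L = Rep_cblinfun f"
    using Rep_cblinfun_cases[of L] by auto
  have "X \<longlonglongrightarrow> f"
    using L unfolding f tendsto_iff dist_cblinfun_def
    by (simp add: dist_norm norm_cblinfun.rep_eq minus_cblinfun.rep_eq)
  then show "convergent X" by (auto simp: convergent_def)
qed

instantiation cblinfun :: (complex_banach, complex_banach) complex_banach
begin

lift_definition scaleC_cblinfun :: "complex \<Rightarrow> ('a, 'b) cblinfun \<Rightarrow> ('a, 'b) cblinfun"
  is scaleC_blinfun by (simp add: scaleC_blinfun.rep_eq scaleC_scaleC mult.commute)

instance
proof
  fix f g :: "('a, 'b) cblinfun" and c d :: complex and r :: real
  show "c *\<^sub>C (f + g) = c *\<^sub>C f + c *\<^sub>C g"
    by transfer (rule blinfun_eqI, simp add: scaleC_blinfun.rep_eq blinfun.add_left scaleC_add_right)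
  show "(c + d) *\<^sub>C f = c *\<^sub>C f + d *\<^sub>C f"
    by transfer (rule blinfun_eqI, simp add: scaleC_blinfun.rep_eq blinfun.add_left scaleC_add_left)
  show "c *\<^sub>C d *\<^sub>C f = (c * d) *\<^sub>C f"
    by transfer (rule blinfun_eqI, simp add: scaleC_blinfun.rep_eq scaleC_scaleC)
  show "r *\<^sub>R f = complex_of_real r *\<^sub>C f"
    by transfer
       (rule blinfun_eqI, simp add: scaleC_blinfun.rep_eq blinfun.scaleR_left,
        rule scaleR_scaleC)
  show "norm (c *\<^sub>C f) = cmod c * norm f"
    by transfer (rule norm_scaleC_blinfun)
qed

end

lemma cblinfun_compose_assoc:
  "cblinfun_compose (cblinfun_compose R S) T = cblinfun_compose R (cblinfun_compose S T)"
  by transfer (auto intro!: blinfun_eqI)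

lemma cblinfun_compose_add_left:
  "cblinfun_compose (R + S) T = cblinfun_compose R T + cblinfun_compose S T"
  by transfer (auto intro!: blinfun_eqI simp: blinfun.add_left)

lemma cblinfun_compose_add_right:
  "cblinfun_compose R (S + T) = cblinfun_compose R S + cblinfun_compose R T"
  by transfer (auto intro!: blinfun_eqI simp: blinfun.add_left blinfun.add_right)

lemma cblinfun_compose_scaleC_left:
  "cblinfun_compose (c *\<^sub>C S) T = c *\<^sub>C cblinfun_compose S T"
  by transfer (auto intro!: blinfun_eqI simp: scaleC_blinfun.rep_eq)

lemma cblinfun_compose_scaleC_right:
  "cblinfun_compose S (c *\<^sub>C T) = c *\<^sub>C cblinfun_compose S T"
  by transfer (auto intro!: blinfun_eqI simp: scaleC_blinfun.rep_eq)

lemma norm_cblinfun_compose: "norm (cblinfun_compose S T) \<le> norm S * norm T"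
  by transfer (rule norm_blinfun_compose)

type_synonym 'a dual = "('a, complex) cblinfun"


section \<open>The Banach algebra of compact operators\<close>

definition compact_operator :: "('a::complex_banach, 'b::complex_banach) cblinfun \<Rightarrow> bool" where
  "compact_operator T \<longleftrightarrow> compact (closure (cblinfun_apply T ` cball 0 1))"


lemma compact_operatorI:
  assumes "compact K" "cblinfun_apply T ` cball 0 1 \<subseteq> K"
  shows "compact_operator T"
proof -
  have "closure (cblinfun_apply T ` cball 0 1) \<subseteq> K"
    using assms by (simp add: closure_minimal compact_imp_closed)
  then show ?thesis
    unfolding compact_operator_def using assms(1)
    by (metis closed_closure compact_Int_closed inf.absorb_iff2)
qed

lemma compact_operatorE:
  assumes "compact_operator T"
  obtains K where "compact K" "\<And>x. norm x \<le> 1 \<Longrightarrow> cblinfun_apply T x \<in> K"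
  using assms unfolding compact_operator_def
  by (metis closure_subset image_subset_iff mem_cball_0)

lemma norm_cblinfun_apply: "norm (cblinfun_apply T x) \<le> norm T * norm x"
  by transfer (rule norm_blinfun)

lemma compact_operator_zero: "compact_operator 0"
  by (rule compact_operatorI[of "{0}"]) (auto simp: cblinfun_apply_def zero_cblinfun.rep_eq)

lemma compact_operator_add:
  assumes "compact_operator S" "compact_operator T"
  shows "compact_operator (S + T)"
proof -
  obtain K where K: "compact K" "\<And>x. norm x \<le> 1 \<Longrightarrow> cblinfun_apply S x \<in> K"
    using assms(1) by (rule compact_operatorE) blast
  obtain L where L: "compact L" "\<And>x. norm x \<le> 1 \<Longrightarrow> cblinfun_apply T x \<in> L"
    using assms(2) by (rule compact_operatorE) blast
  show ?thesis
    by (rule compact_operatorI[OF compact_sums[OF K(1) L(1)]])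
       (use K(2) L(2) in \<open>fastforce simp: cblinfun_apply_def plus_cblinfun.rep_eq blinfun.add_left\<close>)
qed

lemma compact_operator_scaleC:
  assumes "compact_operator T"
  shows "compact_operator (c *\<^sub>C T)"
proof -
  obtain K where K: "compact K" "\<And>x. norm x \<le> 1 \<Longrightarrow> cblinfun_apply T x \<in> K"
    using assms by (rule compact_operatorE) blast
  have "compact ((\<lambda>x. c *\<^sub>C x) ` K)"
    using K(1) by (intro compact_continuous_image linear_continuous_on bounded_linear_scaleC)
  then show ?thesis
    by (rule compact_operatorI)
       (use K(2) in \<open>auto simp: cblinfun_apply_def scaleC_cblinfun.rep_eq scaleC_blinfun.rep_eq\<close>)
qed

lemma compact_operator_scaleR: "compact_operator T \<Longrightarrow> compact_operator (r *\<^sub>R T)"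
  by (simp add: scaleR_scaleC compact_operator_scaleC)

lemma compact_operator_uminus: "compact_operator T \<Longrightarrow> compact_operator (- T)"
  using compact_operator_scaleR[of T "-1"] by simp

lemma compact_operator_diff:
  "compact_operator S \<Longrightarrow> compact_operator T \<Longrightarrow> compact_operator (S - T)"
  using compact_operator_add[of S "- T"] compact_operator_uminus[of T] by simp

lemma compact_operator_compose:
  assumes "compact_operator S"
  shows "compact_operator (cblinfun_compose S T)"
proof -
  obtain K where K: "compact K" "\<And>x. norm x \<le> 1 \<Longrightarrow> cblinfun_apply S x \<in> K"
    using assms by (rule compact_operatorE) blast
  have "compact ((\<lambda>x. (norm T + 1) *\<^sub>R x) ` K)"
    using K(1) by (rule compact_scaling)
  then show ?thesis
  proof (rule compact_operatorI, safe)
    fix x :: 'c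
    assume "x \<in> cball 0 1"
    then have "norm x \<le> 1" by simp
    define y where "y = cblinfun_apply T x /\<^sub>R (norm T + 1)"
    have pos: "norm T + 1 > 0"
      by (simp add: add_nonneg_pos)
    have "norm (cblinfun_apply T x) \<le> norm T * 1"
      using norm_cblinfun_apply[of T x] \<open>norm x \<le> 1\<close> mult_left_mono[of "norm x" 1 "norm T"]
      by simp
    then have "norm y \<le> 1"
      using pos unfolding y_def by (simp add: divide_simps)
    moreover have "cblinfun_apply (cblinfun_compose S T) x = (norm T + 1) *\<^sub>R cblinfun_apply S y"
      using pos unfolding y_def
      by (simp add: cblinfun_apply_def cblinfun_compose.rep_eq blinfun.scaleR_right)
    ultimately show "cblinfun_apply (cblinfun_compose S T) x \<in> (\<lambda>x. (norm T + 1) *\<^sub>R x) ` K"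
      using K(2) by auto
  qed
qed

lemma compact_operator_limit:
  assumes "\<And>n. compact_operator (X n)" "X \<longlonglongrightarrow> T"
  shows "compact_operator T"
proof -
  let ?S = "cblinfun_apply T ` cball 0 1"
  have "\<exists>F. finite F \<and> closure ?S \<subseteq> (\<Union>x\<in>F. ball x e)" if "e > 0" for e
  proof -
    obtain n where n: "norm (X n - T) < e / 4"
      using LIMSEQ_D[OF assms(2), of "e / 4"] \<open>e > 0\<close> by auto
    obtain K where K: "compact K" "\<And>x. norm x \<le> 1 \<Longrightarrow> cblinfun_apply (X n) x \<in> K"
      using assms(1) by (rule compact_operatorE) blast
    obtain F where F: "finite F" "K \<subseteq> (\<Union>x\<in>F. ball x (e / 4))"
      using K(1) \<open>e > 0\<close> unfolding compact_eq_totally_bounded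
      by (metis divide_pos_pos zero_less_numeral)
    have "?S \<subseteq> (\<Union>x\<in>F. cball x (e / 2))"
    proof safe
      fix x :: 'a
      assume "x \<in> cball 0 1"
      then have x: "norm x \<le> 1" by simp
      then obtain y where y: "y \<in> F" "dist y (cblinfun_apply (X n) x) < e / 4"
        using K(2) F(2) by fastforce
      have "dist (cblinfun_apply (X n) x) (cblinfun_apply T x)
          = norm (cblinfun_apply (X n - T) x)"
        by (simp add: dist_norm cblinfun_apply_def minus_cblinfun.rep_eq blinfun.diff_left)
      also have "\<dots> \<le> norm (X n - T) * 1"
        using norm_cblinfun_apply[of "X n - T" x] mult_left_mono[OF x, of "norm (X n - T)"]
        by simp
      finally have "dist y (cblinfun_apply T x) \<le> e / 2"
        using n y(2) dist_triangle[of y "cblinfun_apply T x" "cblinfun_apply (X n) x"]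
        by simp
      then show "cblinfun_apply T x \<in> (\<Union>x\<in>F. cball x (e / 2))"
        using y(1) by auto
    qed
    then have "closure ?S \<subseteq> (\<Union>x\<in>F. cball x (e / 2))"
      using F(1) by (intro closure_minimal) (auto intro!: closed_UN)
    also have "\<dots> \<subseteq> (\<Union>x\<in>F. ball x e)"
      using \<open>e > 0\<close> by fastforce
    finally show ?thesis using F(1) by blast
  qed
  then show ?thesis
    unfolding compact_operator_def compact_eq_totally_bounded
    by (simp add: complete_eq_closed)
qed

typedef (overloaded) 'a compact_op = "{T :: ('a::complex_banach, 'a) cblinfun. compact_operator T}"
  using compact_operator_zero by blast

setup_lifting type_definition_compact_op

instantiation compact_op :: (complex_banach) real_normed_algebra
begin

lift_definition zero_compact_op :: "'a compact_op" is 0 by (rule compact_operator_zero)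
lift_definition plus_compact_op :: "'a compact_op \<Rightarrow> 'a compact_op \<Rightarrow> 'a compact_op"
  is "(+)" by (rule compact_operator_add)
lift_definition minus_compact_op :: "'a compact_op \<Rightarrow> 'a compact_op \<Rightarrow> 'a compact_op"
  is "(-)" by (rule compact_operator_diff)
lift_definition uminus_compact_op :: "'a compact_op \<Rightarrow> 'a compact_op"
  is uminus by (rule compact_operator_uminus)
lift_definition scaleR_compact_op :: "real \<Rightarrow> 'a compact_op \<Rightarrow> 'a compact_op"
  is "(*\<^sub>R)" by (rule compact_operator_scaleR)
lift_definition times_compact_op :: "'a compact_op \<Rightarrow> 'a compact_op \<Rightarrow> 'a compact_op"
  is cblinfun_compose by (rule compact_operator_compose)
lift_definition norm_compact_op :: "'a compact_op \<Rightarrow> real" is norm .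

definition sgn_compact_op :: "'a compact_op \<Rightarrow> 'a compact_op" where
  "sgn_compact_op f = inverse (norm f) *\<^sub>R f"
definition dist_compact_op :: "'a compact_op \<Rightarrow> 'a compact_op \<Rightarrow> real" where
  "dist_compact_op f g = norm (f - g)"
definition uniformity_compact_op :: "('a compact_op \<times> 'a compact_op) filter" where
  "uniformity_compact_op = (INF e\<in>{0<..}. principal {(f, g). dist f g < e})"
definition open_compact_op :: "'a compact_op set \<Rightarrow> bool" where
  "open_compact_op U \<longleftrightarrow> (\<forall>f\<in>U. \<forall>\<^sub>F (f', g) in uniformity. f' = f \<longrightarrow> g \<in> U)"

instance
proof
  fix f g h :: "'a compact_op" and r :: real
  show "f * g * h = f * (g * h)"
    by transfer (rule cblinfun_compose_assoc)
  show "(f + g) * h = f * h + g * h"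
    by transfer (rule cblinfun_compose_add_left)
  show "f * (g + h) = f * g + f * h"
    by transfer (rule cblinfun_compose_add_right)
  show "r *\<^sub>R f * g = r *\<^sub>R (f * g)"
    by transfer (simp only: scaleR_scaleC cblinfun_compose_scaleC_left)
  show "f * r *\<^sub>R g = r *\<^sub>R (f * g)"
    by transfer (simp only: scaleR_scaleC cblinfun_compose_scaleC_right)
  show "norm (f * g) \<le> norm f * norm g"
    by transfer (rule norm_cblinfun_compose)
qed (rule sgn_compact_op_def dist_compact_op_def uniformity_compact_op_def open_compact_op_def
     | (transfer, simp add: algebra_simps norm_triangle_ineq; fail))+

end

instance compact_op :: (complex_banach) banach
proof
  fix X :: "nat \<Rightarrow> 'a::complex_banach compact_op"
  assume "Cauchy X"
  then have "Cauchy (\<lambda>n. Rep_compact_op (X n))"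
    unfolding Cauchy_def dist_compact_op_def
    by (simp add: dist_norm norm_compact_op.rep_eq minus_compact_op.rep_eq)
  then obtain L where L: "(\<lambda>n. Rep_compact_op (X n)) \<longlonglongrightarrow> L"
    using Cauchy_convergent_iff convergent_def by blast
  have "compact_operator L"
    by (rule compact_operator_limit[OF _ L]) (use Rep_compact_op in auto)
  then obtain f where f: "L = Rep_compact_op f"
    using Rep_compact_op_cases[of L] by auto
  have "X \<longlonglongrightarrow> f"
    using L unfolding f tendsto_iff dist_compact_op_def
    by (simp add: dist_norm norm_compact_op.rep_eq minus_compact_op.rep_eq)
  then show "convergent X" by (auto simp: convergent_def)
qed

instantiation compact_op :: (complex_banach) complex_banach_algebra
begin

lift_definition scaleC_compact_op :: "complex \<Rightarrow> 'a compact_op \<Rightarrow> 'a compact_op"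
  is "(*\<^sub>C)" by (rule compact_operator_scaleC)

instance
proof
  fix f g :: "'a compact_op" and c :: complex
  show "c *\<^sub>C f * g = c *\<^sub>C (f * g)"
    by transfer (rule cblinfun_compose_scaleC_left)
  show "f * c *\<^sub>C g = c *\<^sub>C (f * g)"
    by transfer (rule cblinfun_compose_scaleC_right)
qed (transfer, rule scaleC_add_right scaleC_add_left scaleC_scaleC scaleR_scaleC norm_scaleC)+

end


section \<open>Banach bimodules and amenability\<close>

text \<open>
  Amenability quantifies over all Banach bimodules, hence over spaces on different underlying
  sets. A bimodule is therefore a record whose underlying set is an arbitrary subset of a
  type \<open>'z\<close>, with its own operations and norm; nothing is required of \<open>'z\<close> itself.
\<close>

record ('a, 'z) bimodule =
  points :: "'z set"
  vzero :: 'z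
  vadd :: "'z \<Rightarrow> 'z \<Rightarrow> 'z"
  vscale :: "complex \<Rightarrow> 'z \<Rightarrow> 'z"
  vnorm :: "'z \<Rightarrow> real"
  lact :: "'a \<Rightarrow> 'z \<Rightarrow> 'z"
  ract :: "'z \<Rightarrow> 'a \<Rightarrow> 'z"

definition vdiff :: "('a, 'z) bimodule \<Rightarrow> 'z \<Rightarrow> 'z \<Rightarrow> 'z" where
  "vdiff Z x y = vadd Z x (vscale Z (-1) y)"

locale banach_bimodule =
  fixes Z :: "('a::complex_banach_algebra, 'z) bimodule"
  assumes vzero_closed: "vzero Z \<in> points Z"
    and vadd_closed: "\<lbrakk>x \<in> points Z; y \<in> points Z\<rbrakk> \<Longrightarrow> vadd Z x y \<in> points Z"
    and vscale_closed: "x \<in> points Z \<Longrightarrow> vscale Z c x \<in> points Z"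
    and vadd_assoc: "\<lbrakk>x \<in> points Z; y \<in> points Z; z \<in> points Z\<rbrakk>
      \<Longrightarrow> vadd Z (vadd Z x y) z = vadd Z x (vadd Z y z)"
    and vadd_commute: "\<lbrakk>x \<in> points Z; y \<in> points Z\<rbrakk> \<Longrightarrow> vadd Z x y = vadd Z y x"
    and vadd_vzero: "x \<in> points Z \<Longrightarrow> vadd Z x (vzero Z) = x"
    and vdiff_self: "x \<in> points Z \<Longrightarrow> vdiff Z x x = vzero Z"
    and vscale_vadd: "\<lbrakk>x \<in> points Z; y \<in> points Z\<rbrakk>
      \<Longrightarrow> vscale Z c (vadd Z x y) = vadd Z (vscale Z c x) (vscale Z c y)"
    and vscale_add: "x \<in> points Z \<Longrightarrow> vscale Z (c + d) x = vadd Z (vscale Z c x) (vscale Z d x)"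
    and vscale_vscale: "x \<in> points Z \<Longrightarrow> vscale Z c (vscale Z d x) = vscale Z (c * d) x"
    and vscale_one: "x \<in> points Z \<Longrightarrow> vscale Z 1 x = x"
    and vnorm_nonneg: "x \<in> points Z \<Longrightarrow> 0 \<le> vnorm Z x"
    and vnorm_eq_0: "x \<in> points Z \<Longrightarrow> vnorm Z x = 0 \<longleftrightarrow> x = vzero Z"
    and vnorm_vscale: "x \<in> points Z \<Longrightarrow> vnorm Z (vscale Z c x) = cmod c * vnorm Z x"
    and vnorm_vadd: "\<lbrakk>x \<in> points Z; y \<in> points Z\<rbrakk>
      \<Longrightarrow> vnorm Z (vadd Z x y) \<le> vnorm Z x + vnorm Z y"
    and complete: "Metric_space.mcomplete (points Z) (\<lambda>x y. vnorm Z (vdiff Z x y))"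
    and lact_closed: "x \<in> points Z \<Longrightarrow> lact Z a x \<in> points Z"
    and ract_closed: "x \<in> points Z \<Longrightarrow> ract Z x a \<in> points Z"
    and lact_vadd: "\<lbrakk>x \<in> points Z; y \<in> points Z\<rbrakk>
      \<Longrightarrow> lact Z a (vadd Z x y) = vadd Z (lact Z a x) (lact Z a y)"
    and lact_vscale: "x \<in> points Z \<Longrightarrow> lact Z a (vscale Z c x) = vscale Z c (lact Z a x)"
    and lact_add: "x \<in> points Z \<Longrightarrow> lact Z (a + b) x = vadd Z (lact Z a x) (lact Z b x)"
    and lact_scaleC: "x \<in> points Z \<Longrightarrow> lact Z (c *\<^sub>C a) x = vscale Z c (lact Z a x)"
    and ract_vadd: "\<lbrakk>x \<in> points Z; y \<in> points Z\<rbrakk>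
      \<Longrightarrow> ract Z (vadd Z x y) a = vadd Z (ract Z x a) (ract Z y a)"
    and ract_vscale: "x \<in> points Z \<Longrightarrow> ract Z (vscale Z c x) a = vscale Z c (ract Z x a)"
    and ract_add: "x \<in> points Z \<Longrightarrow> ract Z x (a + b) = vadd Z (ract Z x a) (ract Z x b)"
    and ract_scaleC: "x \<in> points Z \<Longrightarrow> ract Z x (c *\<^sub>C a) = vscale Z c (ract Z x a)"
    and lact_mult: "x \<in> points Z \<Longrightarrow> lact Z (a * b) x = lact Z a (lact Z b x)"
    and ract_mult: "x \<in> points Z \<Longrightarrow> ract Z x (a * b) = ract Z (ract Z x a) b"
    and lact_ract: "x \<in> points Z \<Longrightarrow> lact Z a (ract Z x b) = ract Z (lact Z a x) b"
    and lact_bounded: "\<exists>C. \<forall>a. \<forall>x\<in>points Z. vnorm Z (lact Z a x) \<le> C * norm a * vnorm Z x"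
    and ract_bounded: "\<exists>C. \<forall>a. \<forall>x\<in>points Z. vnorm Z (ract Z x a) \<le> C * norm a * vnorm Z x"

text \<open>
  The dual \<open>Z*\<close> consists of the bounded linear functionals on \<open>points Z\<close>, made
  \<^const>\<open>extensional\<close> so that functionals agreeing on \<open>points Z\<close> are equal.
\<close>

definition dual_bimodule ::
    "('a::complex_banach_algebra, 'z) bimodule \<Rightarrow> ('a, 'z \<Rightarrow> complex) bimodule" where
  "dual_bimodule Z =
   \<lparr>points = {f \<in> extensional (points Z).
       (\<forall>x\<in>points Z. \<forall>y\<in>points Z. f (vadd Z x y) = f x + f y) \<and>
       (\<forall>c. \<forall>x\<in>points Z. f (vscale Z c x) = c * f x) \<and>
       (\<exists>C. \<forall>x\<in>points Z. cmod (f x) \<le> C * vnorm Z x)},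
    vzero = (\<lambda>x\<in>points Z. 0),
    vadd = (\<lambda>f g. \<lambda>x\<in>points Z. f x + g x),
    vscale = (\<lambda>c f. \<lambda>x\<in>points Z. c * f x),
    vnorm = (\<lambda>f. SUP x\<in>{x \<in> points Z. vnorm Z x \<le> 1}. cmod (f x)),
    lact = (\<lambda>a f. \<lambda>x\<in>points Z. f (ract Z x a)),
    ract = (\<lambda>f a. \<lambda>x\<in>points Z. f (lact Z a x))\<rparr>"

definition continuous_derivation ::
    "('a::complex_banach_algebra, 'z) bimodule \<Rightarrow> ('a \<Rightarrow> 'z) \<Rightarrow> bool" where
  "continuous_derivation E D \<longleftrightarrow>
     (\<forall>a. D a \<in> points E) \<and>
     (\<forall>a b. D (a + b) = vadd E (D a) (D b)) \<and>
     (\<forall>c a. D (c *\<^sub>C a) = vscale E c (D a)) \<and>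
     (\<exists>C. \<forall>a. vnorm E (D a) \<le> C * norm a) \<and>
     (\<forall>a b. D (a * b) = vadd E (lact E a (D b)) (ract E (D a) b))"

definition inner_derivation ::
    "('a::complex_banach_algebra, 'z) bimodule \<Rightarrow> ('a \<Rightarrow> 'z) \<Rightarrow> bool" where
  "inner_derivation E D \<longleftrightarrow> (\<exists>f\<in>points E. \<forall>a. D a = vdiff E (lact E a f) (ract E f a))"

text \<open>
  Amenability of the Banach algebra \<open>'a\<close>, tested on all Banach bimodules whose underlying set
  is a subset of \<open>'z\<close>. Up to renaming of points these are all Banach bimodules of cardinality at
  most that of \<open>'z\<close>. A statement about arbitrary Banach bimodules is obtained by letting \<open>'z\<close> be
  a type variable; as a hypothesis this is not possible in HOL, and there the type
  \<open>'a test_points\<close> is used.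
\<close>

definition amenable_on :: "'z itself \<Rightarrow> 'a::complex_banach_algebra itself \<Rightarrow> bool" where
  "amenable_on _ _ \<longleftrightarrow>
     (\<forall>Z :: ('a, 'z) bimodule. banach_bimodule Z \<longrightarrow>
        (\<forall>D. continuous_derivation (dual_bimodule Z) D \<longrightarrow> inner_derivation (dual_bimodule Z) D))"

text \<open>
  \<open>'a test_points\<close> is large enough for amenability tested on it to imply amenability tested on
  any type: it has room for \<open>A*\<close>, for the space \<open>(A \<otimes> A)*\<close> of bounded bilinear forms and for the
  quotient of the latter by \<open>A*\<close>, whose duals produce, by Johnson's argument, first a bounded
  approximate identity and then a virtual diagonal.
\<close>

type_synonym 'a test_points = "('a \<Rightarrow> 'a \<Rightarrow> complex) set"


section \<open>Approximate identities\<close>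

text \<open>
  The net is a family \<open>e\<close> together with a proper filter on its index type. For a directed index
  set this is the filter of tails; conversely, every proper filter with these limits yields a net
  (order the pairs \<open>(S, i)\<close> with \<open>S\<close> in the filter and \<open>i \<in> S\<close> by reverse inclusion of \<open>S\<close>).
\<close>

definition bounded_approximate_identity ::
    "('i \<Rightarrow> 'a::complex_banach_algebra) \<Rightarrow> 'i filter \<Rightarrow> bool" where
  "bounded_approximate_identity e F \<longleftrightarrow>
     F \<noteq> bot \<and> (\<exists>C. \<forall>i. norm (e i) \<le> C) \<and>
     (\<forall>a. ((\<lambda>i. e i * a) \<longlongrightarrow> a) F \<and> ((\<lambda>i. a * e i) \<longlongrightarrow> a) F)"

end

theory Submission
  imports Defs
begin

text \<open>
  Write \<open>A\<close> for \<open>K(X*)\<close> and \<open>B\<close> for \<open>K(X)\<close>. The proof rests on the fact that \<open>B\<close> is, up to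
  reversing products, a left ideal of \<open>A\<close>: taking adjoints embeds the opposite algebra of \<open>B\<close> into
  \<open>A\<close>, and if \<open>T\<close> is compact and \<open>S\<close> is any bounded operator on \<open>X*\<close>, then \<open>S T*\<close> is again
  the adjoint of a compact operator on \<open>X\<close>. Indeed, the adjoint \<open>T** S*\<close> of \<open>S T*\<close> takes its
  values in \<open>X\<close>, because the bidual of a compact operator maps the whole bidual into the original
  space (\<open>compact_bidual_value\<close>, \<open>compose_adjoint_compact\<close>).

  An amenable Banach algebra passes its amenability on to each closed left ideal that has a bounded
  two-sided approximate identity. If \<open>\<Sum> x \<otimes> b\<close> runs through a bounded approximate diagonal of
  \<open>A\<close>, then \<open>\<Sum> x e \<otimes> b e'\<close> is an approximate diagonal of the ideal, provided that \<open>e\<close> goes to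
  its limit first: moving an element \<open>c\<close> of the ideal from one side to the other costs, beyond the
  error of the diagonal of \<open>A\<close>, only \<open>e' c - c e'\<close>, which is small uniformly in the diagonal. The theorem
  \<open>amenable_of_multiplier_action\<close> carries this out with limits instead of approximations and with
  left ideals replaced by algebras on which \<open>A\<close> acts by multipliers.

  Two devices keep the argument free of tensor products and of iterated approximations. The diagonal
  is replaced by a single bounded functional \<open>M\<close> on the space of bounded bilinear forms on
  \<open>A# \<times> A\<close>, where \<open>A#\<close> is the unitization; this space is the dual of the kernel of the
  multiplication of \<open>A#\<close>, and one application of amenability to the universal derivation into its
  dual gives \<open>M\<close> (\<open>amenable_universal_functional\<close>). Limits along the approximate identity
  are taken by a bounded linear functional on all bounded families (\<open>generalized_limit_exists\<close>), so
  that the limit in \<open>e\<close> can be performed inside the forms to which \<open>M\<close> is applied. The terms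
  which in the classical proof are removed by first passing to essential bimodules are collected
  explicitly in the functional that implements the derivation (\<open>d_inner\<close>).
\<close>

section \<open>Operators given by their values\<close>

lemma cblinfun_apply_simps [simp]:
  "cblinfun_apply f (x + y) = cblinfun_apply f x + cblinfun_apply f y"
  "cblinfun_apply f (x - y) = cblinfun_apply f x - cblinfun_apply f y"
  "cblinfun_apply f (- x) = - cblinfun_apply f x"
  "cblinfun_apply f 0 = 0"
  "cblinfun_apply f (c *\<^sub>C x) = c *\<^sub>C cblinfun_apply f x"
  "cblinfun_apply f (r *\<^sub>R x) = r *\<^sub>R cblinfun_apply f x"
  using Rep_cblinfun[of f]
  by (simp_all add: cblinfun_apply_def blinfun.add_right blinfun.diff_right blinfun.minus_right
      blinfun.scaleR_right)

lemma cblinfun_arith_apply [simp]: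
  "cblinfun_apply (f + g) x = cblinfun_apply f x + cblinfun_apply g x"
  "cblinfun_apply (f - g) x = cblinfun_apply f x - cblinfun_apply g x"
  "cblinfun_apply (- f) x = - cblinfun_apply f x"
  "cblinfun_apply 0 x = 0"
  "cblinfun_apply (c *\<^sub>C f) x = c *\<^sub>C cblinfun_apply f x"
  "cblinfun_apply (cblinfun_compose h k) z = cblinfun_apply h (cblinfun_apply k z)"
  by (simp_all add: cblinfun_apply_def plus_cblinfun.rep_eq minus_cblinfun.rep_eq
      uminus_cblinfun.rep_eq zero_cblinfun.rep_eq scaleC_cblinfun.rep_eq scaleC_blinfun.rep_eq
      cblinfun_compose.rep_eq blinfun.add_left blinfun.diff_left blinfun.minus_left)

lemma cblinfun_eqI: "(\<And>x. cblinfun_apply f x = cblinfun_apply g x) \<Longrightarrow> f = g"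
  by (metis Rep_cblinfun_inject blinfun_eqI cblinfun_apply.rep_eq)

lemma bounded_linear_cblinfun_apply: "bounded_linear (cblinfun_apply f)"
  unfolding cblinfun_apply.rep_eq by (rule blinfun.bounded_linear_right)

lemma norm_cblinfun_bound:
  assumes "0 \<le> C" "\<And>x. norm (cblinfun_apply f x) \<le> C * norm x"
  shows "norm f \<le> C"
  using assms by transfer (rule norm_blinfun_bound)

lemma norm_cblinfun_bound_ball:
  assumes "0 \<le> C" "\<And>x. norm x \<le> 1 \<Longrightarrow> norm (cblinfun_apply f x) \<le> C"
  shows "norm f \<le> C"
proof (rule norm_cblinfun_bound[OF assms(1)])
  fix x
  show "norm (cblinfun_apply f x) \<le> C * norm x"
  proof (cases "x = 0")
    case False
    then have "norm (cblinfun_apply f (x /\<^sub>R norm x)) \<le> C"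
      by (intro assms(2)) simp
    then show ?thesis using False by (simp add: field_simps)
  qed simp
qed

lemma cblinfun_exists:
  fixes f :: "'a::complex_banach \<Rightarrow> 'b::complex_banach"
  assumes "\<And>x y. f (x + y) = f x + f y" "\<And>c x. f (c *\<^sub>C x) = c *\<^sub>C f x"
    and "\<And>x. norm (f x) \<le> C * norm x"
  obtains F where "cblinfun_apply F = f"
proof -
  have "bounded_linear f"
    using assms by (intro bounded_linear_intro[of f C]) (simp_all add: scaleR_scaleC mult.commute)
  then have "cblinfun_apply (Abs_cblinfun (Blinfun f)) = f"
    using assms(2) by (simp add: cblinfun_apply_def Abs_cblinfun_inverse bounded_linear_Blinfun_apply)
  then show thesis by (rule that)
qed

section \<open>Norming functionals\<close>

definition sublinear :: "('a::real_vector \<Rightarrow> real) \<Rightarrow> bool" where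
  "sublinear p \<longleftrightarrow> (\<forall>x y. p (x + y) \<le> p x + p y) \<and> (\<forall>r x. 0 \<le> r \<longrightarrow> p (r *\<^sub>R x) = r * p x)"

lemma sublinear_add: "sublinear p \<Longrightarrow> p (x + y) \<le> p x + p y"
  and sublinear_scaleR: "sublinear p \<Longrightarrow> 0 \<le> r \<Longrightarrow> p (r *\<^sub>R x) = r * p x"
  by (auto simp: sublinear_def)

lemma sublinear_zero: "sublinear p \<Longrightarrow> p 0 = 0"
  using sublinear_scaleR[of p 0 0] by simp

lemma sublinear_minus: "sublinear p \<Longrightarrow> - p (- x) \<le> p x"
  using sublinear_add[of p x "- x"] sublinear_zero[of p] by simp

text \<open>
  The infimum of a chain is subadditive because two members can be replaced by the smaller of
  them. This is the chain condition for Zorn's lemma.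
\<close>

lemma sublinear_INF_chain:
  assumes C: "C \<noteq> {}" "\<And>p. p \<in> C \<Longrightarrow> sublinear p" "\<And>p q. p \<in> C \<Longrightarrow> q \<in> C \<Longrightarrow> p \<le> q \<or> q \<le> p"
    and p0: "\<And>p. p \<in> C \<Longrightarrow> p \<le> p0"
  defines "u \<equiv> \<lambda>x. INF p\<in>C. p x"
  shows "sublinear u" "p \<in> C \<Longrightarrow> u \<le> p"
proof -
  have bdd: "bdd_below ((\<lambda>p. p x) ` C)" for x
  proof (rule bdd_belowI2)
    fix p assume "p \<in> C"
    then show "- p0 (- x) \<le> p x"
      using sublinear_minus[OF C(2)[OF \<open>p \<in> C\<close>], of x] le_funD[OF p0[OF \<open>p \<in> C\<close>], of "- x"] by simp
  qed
  have le: "u x \<le> p x" if "p \<in> C" for p x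
    unfolding u_def by (rule cINF_lower[OF bdd that])
  then show "p \<in> C \<Longrightarrow> u \<le> p" by (simp add: le_fun_def)
  have ge: "m \<le> u x" if "\<And>p. p \<in> C \<Longrightarrow> m \<le> p x" for m x
    unfolding u_def by (rule cINF_greatest[OF C(1) that])
  have sc: "r * u x \<le> u (r *\<^sub>R x)" if "0 \<le> r" for r x
    by (rule ge) (use that C(2) le in \<open>auto simp: sublinear_scaleR intro: mult_left_mono\<close>)
  show "sublinear u"
    unfolding sublinear_def
  proof (intro conjI allI impI)
    fix x y
    have "u (x + y) - q y \<le> u x" if q: "q \<in> C" for q
    proof (rule ge)
      fix p assume p: "p \<in> C"
      obtain s where s: "s \<in> C" "s \<le> p" "s \<le> q"
        using C(3)[OF p q] p q by blast
      have "u (x + y) \<le> s x + s y"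
        using le[OF s(1)] sublinear_add[OF C(2)[OF s(1)]] order_trans by blast
      then show "u (x + y) - q y \<le> p x"
        using s(2,3) by (simp add: le_fun_def) (smt (verit))
    qed
    then have "u (x + y) - u x \<le> u y"
      by (intro ge) (simp add: algebra_simps)
    then show "u (x + y) \<le> u x + u y" by simp
  next
    fix r x assume r: "0 \<le> (r::real)"
    show "u (r *\<^sub>R x) = r * u x"
    proof (cases "r = 0")
      case True
      have "u 0 = 0"
      proof (rule antisym)
        obtain p where "p \<in> C" using C(1) by auto
        then show "u 0 \<le> 0" using le[of p 0] sublinear_zero[OF C(2)[of p]] by simp
        show "0 \<le> u 0" by (rule ge) (simp add: sublinear_zero[OF C(2)])
      qed
      then show ?thesis using True by simp
    next
      case False
      then have "inverse r * u (r *\<^sub>R x) \<le> u x"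
        using sc[of "inverse r" "r *\<^sub>R x"] r by simp
      then have "u (r *\<^sub>R x) \<le> r * u x" using False r by (simp add: field_simps)
      then show ?thesis using sc[OF r, of x] by simp
    qed
  qed
qed

text \<open>
  Lowering \<open>p\<close> in the direction \<open>x\<close>: the new functional takes a value of at most \<open>- p x\<close> at \<open>- x\<close>. Hence a
  minimal sublinear functional is odd, that is, linear; and starting from the norm, a linear
  functional below the result attains the norm at \<open>x\<close>.
\<close>

lemma sublinear_shift:
  fixes x :: "'a::real_vector"
  assumes p: "sublinear p"
  defines "q \<equiv> \<lambda>y. INF t\<in>{0..}. p (y + t *\<^sub>R x) - t * p x"
  shows "sublinear q" "q \<le> p" "q (- x) \<le> - p x"
proof -
  have bdd: "bdd_below ((\<lambda>t. p (y + t *\<^sub>R x) - t * p x) ` {0..})" for y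
  proof (rule bdd_belowI2)
    fix t :: real assume "t \<in> {0..}"
    then have "t * p x = p (t *\<^sub>R x)" by (simp add: sublinear_scaleR[OF p])
    also have "\<dots> \<le> p (y + t *\<^sub>R x) + p (- y)"
      using sublinear_add[OF p, of "y + t *\<^sub>R x" "- y"] by simp
    finally show "- p (- y) \<le> p (y + t *\<^sub>R x) - t * p x" by simp
  qed
  have le: "q y \<le> p (y + t *\<^sub>R x) - t * p x" if "0 \<le> t" for y t
    unfolding q_def by (rule cINF_lower[OF bdd]) (use that in simp)
  have ge: "m \<le> q y" if "\<And>t. 0 \<le> t \<Longrightarrow> m \<le> p (y + t *\<^sub>R x) - t * p x" for m y
    unfolding q_def by (rule cINF_greatest) (use that in auto)
  show "q \<le> p" using le[of 0] by (simp add: le_fun_def)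
  show "q (- x) \<le> - p x" using le[of 1 "- x"] sublinear_zero[OF p] by simp
  have sc: "r * q y \<le> q (r *\<^sub>R y)" if r: "0 < r" for r y
  proof (rule ge)
    fix t :: real assume t: "0 \<le> t"
    have "r *\<^sub>R y + t *\<^sub>R x = r *\<^sub>R (y + (t / r) *\<^sub>R x)" using r by (simp add: algebra_simps)
    then have "p (r *\<^sub>R y + t *\<^sub>R x) - t * p x = r * (p (y + (t / r) *\<^sub>R x) - (t / r) * p x)"
      using sublinear_scaleR[OF p, of r "y + (t / r) *\<^sub>R x"] r by (simp add: right_diff_distrib)
    moreover have "r * q y \<le> r * (p (y + (t / r) *\<^sub>R x) - (t / r) * p x)"
      using le[of "t / r" y] t r by (intro mult_left_mono) auto
    ultimately show "r * q y \<le> p (r *\<^sub>R y + t *\<^sub>R x) - t * p x" by simp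
  qed
  show "sublinear q"
    unfolding sublinear_def
  proof (intro conjI allI impI)
    fix y z
    have "q (y + z) - (p (z + s *\<^sub>R x) - s * p x) \<le> q y" if s: "0 \<le> s" for s
    proof (rule ge)
      fix t :: real assume t: "0 \<le> t"
      have "q (y + z) \<le> p ((y + t *\<^sub>R x) + (z + s *\<^sub>R x)) - (t + s) * p x"
        using le[of "t + s" "y + z"] s t by (simp add: algebra_simps)
      also have "\<dots> \<le> p (y + t *\<^sub>R x) + p (z + s *\<^sub>R x) - (t + s) * p x"
        using sublinear_add[OF p] by simp
      finally show "q (y + z) - (p (z + s *\<^sub>R x) - s * p x) \<le> p (y + t *\<^sub>R x) - t * p x"
        by (simp add: algebra_simps)
    qed
    then have "q (y + z) - q y \<le> q z" by (intro ge) (simp add: algebra_simps)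
    then show "q (y + z) \<le> q y + q z" by simp
  next
    fix r :: real and y assume r: "0 \<le> r"
    show "q (r *\<^sub>R y) = r * q y"
    proof (cases "r = 0")
      case True
      have "q 0 = 0"
        using le[of 0 0] ge[of 0 0] by (simp add: sublinear_zero[OF p] sublinear_scaleR[OF p])
      then show ?thesis using True by simp
    next
      case False
      then have "inverse r * q (r *\<^sub>R y) \<le> q y" using sc[of "inverse r" "r *\<^sub>R y"] r by simp
      then have "q (r *\<^sub>R y) \<le> r * q y" using False r by (simp add: field_simps)
      then show ?thesis using sc[of r y] False r by simp
    qed
  qed
qed

lemma linear_below_sublinear:
  fixes p :: "'a::real_vector \<Rightarrow> real"
  assumes p: "sublinear p"
  obtains u where "linear u" "u \<le> p"
proof -
  define A where "A = {q. sublinear q \<and> q \<le> p}"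
  have "\<exists>m\<in>A. \<forall>a\<in>A. a \<le> m \<longrightarrow> a = m"
  proof (rule predicate_Zorn)
    show "partial_order_on A (relation_of (\<lambda>x y. y \<le> x) A)"
      by (rule partial_order_on_relation_ofI) auto
    fix C assume "C \<in> Chains (relation_of (\<lambda>x y. y \<le> x) A)"
    then have C: "C \<subseteq> A" "\<And>q r. q \<in> C \<Longrightarrow> r \<in> C \<Longrightarrow> q \<le> r \<or> r \<le> q"
      by (auto simp: Chains_def relation_of_def)
    show "\<exists>u\<in>A. \<forall>a\<in>C. u \<le> a"
    proof (cases "C = {}")
      case True
      then show ?thesis using p by (auto simp: A_def)
    next
      case False
      have *: "\<And>q. q \<in> C \<Longrightarrow> sublinear q" "\<And>q. q \<in> C \<Longrightarrow> q \<le> p" using C(1) by (auto simp: A_def)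
      note INF = sublinear_INF_chain[OF False *(1) C(2) *(2)]
      obtain q where "q \<in> C" using False by blast
      then have "(\<lambda>x. INF q\<in>C. q x) \<in> A"
        using INF *(2)[of q] unfolding A_def by (auto intro: order_trans)
      then show ?thesis using INF(2) by blast
    qed
  qed
  then obtain m where m: "sublinear m" "m \<le> p" "\<And>q. sublinear q \<Longrightarrow> q \<le> p \<Longrightarrow> q \<le> m \<Longrightarrow> q = m"
    by (auto simp: A_def)
  have minus: "m (- x) = - m x" for x
  proof -
    note sh = sublinear_shift[OF m(1), of x]
    have "m (- x) \<le> - m x"
      using sh(3) fun_cong[OF m(3)[OF sh(1) order_trans[OF sh(2) m(2)] sh(2)], of "- x"] by linarith
    then show ?thesis using sublinear_minus[OF m(1), of x] by simp
  qed
  have "linear m"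
  proof (rule linearI)
    fix x y
    show "m (x + y) = m x + m y"
      using sublinear_add[OF m(1), of x y] sublinear_add[OF m(1), of "- x" "- y"]
        minus[of "x + y"] minus[of x] minus[of y] by simp
  next
    fix r x
    show "m (r *\<^sub>R x) = r *\<^sub>R m x"
      using sublinear_scaleR[OF m(1), of r x] sublinear_scaleR[OF m(1), of "- r" x] minus[of "r *\<^sub>R x"]
      by (cases "0 \<le> r") auto
  qed
  then show thesis using m(2) by (rule that)
qed

text \<open>
  The Hahn--Banach theorem. A real-linear \<open>u\<close> dominated by the norm is the real part of the
  complex-linear functional \<open>y \<mapsto> u y - \<i> u (\<i> y)\<close>; rotating \<open>y\<close> so that this value becomes
  positive shows that the norm bound is inherited.
\<close>

lemma norming_functional:
  fixes x :: "'a::complex_banach"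
  obtains f :: "'a dual" where "norm f \<le> 1" "cblinfun_apply f x = complex_of_real (norm x)"
proof -
  have "sublinear (norm :: 'a \<Rightarrow> real)" by (auto simp: sublinear_def norm_triangle_ineq)
  note sh = sublinear_shift[OF this, of x]
  obtain u where u: "linear u" "u \<le> (\<lambda>y. INF t\<in>{0..}. norm (y + t *\<^sub>R x) - t * norm x)"
    using linear_below_sublinear[OF sh(1)] by blast
  have un: "u y \<le> norm y" for y
    using le_funD[OF order_trans[OF u(2) sh(2)]] .
  have "u (- x) \<le> - norm x" using le_funD[OF u(2), of "- x"] sh(3) by (rule order_trans)
  then have ux: "u x = norm x" using un[of x] linear_neg[OF u(1)] by fastforce
  define g where "g y = Complex (u y) (- u (\<i> *\<^sub>C y))" for y
  have add: "g (y + z) = g y + g z" for y z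
    by (simp add: g_def complex_eq_iff linear_add[OF u(1)] scaleC_add_right)
  have uR: "u (r *\<^sub>R y) = r * u y" for r y using linear_cmul[OF u(1)] by simp
  have scale: "g (c *\<^sub>C y) = c * g y" for c y
  proof -
    have c: "c *\<^sub>C y = Re c *\<^sub>R y + Im c *\<^sub>R (\<i> *\<^sub>C y)"
      unfolding scaleR_scaleC scaleC_scaleC scaleC_add_left[symmetric]
      by (rule arg_cong[of _ _ "\<lambda>c. c *\<^sub>C y"]) (simp add: complex_eq_iff)
    have i: "\<i> *\<^sub>C c *\<^sub>C y = Re c *\<^sub>R (\<i> *\<^sub>C y) + (- Im c) *\<^sub>R y"
      unfolding scaleR_scaleC scaleC_scaleC scaleC_add_left[symmetric]
      by (rule arg_cong[of _ _ "\<lambda>c. c *\<^sub>C y"]) (simp add: complex_eq_iff)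
    show ?thesis
      unfolding g_def i unfolding c by (simp add: complex_eq_iff linear_add[OF u(1)] linear_diff[OF u(1)] uR)
  qed
  have bound: "cmod (g y) \<le> norm y" for y
  proof (cases "g y = 0")
    case False
    define c where "c = cnj (g y) / cmod (g y)"
    have "g (c *\<^sub>C y) = cmod (g y)"
      using False complex_norm_square[of "g y"]
      by (simp add: scale c_def power2_eq_square mult.commute divide_eq_eq)
    then have "cmod (g y) = u (c *\<^sub>C y)" by (simp add: g_def complex_eq_iff)
    also have "\<dots> \<le> norm (c *\<^sub>C y)" by (rule un)
    also have "\<dots> = norm y" using False by (simp add: norm_scaleC c_def norm_divide)
    finally show ?thesis .
  qed simp
  obtain f :: "'a dual" where f: "cblinfun_apply f = g"
    using cblinfun_exists[of g 1] add scale bound by (auto simp: scaleC_complex_def)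
  have "Re (g x) = norm x" by (simp add: g_def ux)
  moreover have "cmod (g x) \<le> norm x" by (rule bound)
  moreover have "(cmod (g x))\<^sup>2 = (Re (g x))\<^sup>2 + (Im (g x))\<^sup>2" by (rule cmod_power2)
  ultimately have "g x = norm x"
    using power_mono[of "cmod (g x)" "norm x" 2] by (simp add: complex_eq_iff)
  moreover have "norm f \<le> 1" by (rule norm_cblinfun_bound) (use bound f in auto)
  ultimately show thesis using f that by simp
qed

lemma functionals_separate:
  fixes x y :: "'a::complex_banach"
  assumes "\<And>f :: 'a dual. cblinfun_apply f x = cblinfun_apply f y"
  shows "x = y"
  using norming_functional[of "x - y"] assms
  by (metis cblinfun_apply_simps(2) eq_iff_diff_eq_0 norm_eq_zero of_real_eq_0_iff)

section \<open>Limits of arbitrary bounded families\<close>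

text \<open>
  By Tychonoff's theorem the product of the closures of the ranges of all bounded families is
  compact. The filter, pushed forward to this product by evaluation, has a cluster point, and
  the preimages of its neighbourhoods are added to the filter.
\<close>

lemma convergent_refinement:
  fixes F :: "'i filter"
  assumes "F \<noteq> bot"
  obtains G where "G \<le> F" "G \<noteq> bot"
    "\<And>u :: 'i \<Rightarrow> complex. bounded (range u) \<Longrightarrow> \<exists>l. (u \<longlongrightarrow> l) G"
proof -
  define \<Phi> :: "'i \<Rightarrow> ('i \<Rightarrow> complex) \<Rightarrow> complex"
    where "\<Phi> i u = (if bounded (range u) then u i else 0)" for i u
  define K where "K = (\<Pi>\<^sub>E u\<in>UNIV. closure (range (\<lambda>i. \<Phi> i u)))"
  have bdd: "bounded (range (\<lambda>i. \<Phi> i u))" for u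
    by (cases "bounded (range u)") (auto simp: \<Phi>_def image_constant_conv)
  have "compactin (product_topology (\<lambda>u. euclidean) UNIV) K"
    unfolding K_def by (subst compactin_PiE) (simp add: bdd)
  then have "compact K" by (simp add: euclidean_product_topology)
  moreover have "\<forall>\<^sub>F v in filtermap \<Phi> F. v \<in> K"
    by (auto simp: eventually_filtermap K_def intro!: always_eventually subsetD[OF closure_subset])
  moreover have "filtermap \<Phi> F \<noteq> bot" using assms by (simp add: filtermap_bot_iff)
  ultimately obtain L where L: "inf (nhds L) (filtermap \<Phi> F) \<noteq> bot"
    unfolding compact_filter by blast
  define G where "G = inf F (filtercomap \<Phi> (nhds L))"
  have "G \<noteq> bot"
  proof
    assume "G = bot"
    then obtain P Q where PQ: "eventually P F" "eventually Q (nhds L)" "\<And>i. P i \<Longrightarrow> Q (\<Phi> i) \<Longrightarrow> False"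
      unfolding G_def trivial_limit_def eventually_inf eventually_filtercomap by blast
    have "\<forall>\<^sub>F v in filtermap \<Phi> F. \<not> Q v"
      unfolding eventually_filtermap using PQ(1) by (rule eventually_mono) (use PQ(3) in blast)
    then have "inf (nhds L) (filtermap \<Phi> F) = bot"
      unfolding trivial_limit_def eventually_inf using PQ(2) by blast
    with L show False by contradiction
  qed
  moreover have "\<exists>l. (u \<longlongrightarrow> l) G" if u: "bounded (range u)" for u :: "'i \<Rightarrow> complex"
  proof -
    have "filterlim \<Phi> (nhds L) G"
      using filterlim_filtercomap[of \<Phi> "nhds L"] by (rule filterlim_mono) (simp_all add: G_def)
    then have "((\<lambda>i. \<Phi> i u) \<longlongrightarrow> L u) G"
      by (rule continuous_on_tendsto_compose[OF continuous_on_product_coordinates]) simp_all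
    then show ?thesis using u by (auto simp: \<Phi>_def)
  qed
  ultimately show thesis by (intro that[of G]) (simp_all add: G_def)
qed

locale generalized_limit =
  fixes F :: "'i filter" and Lm :: "('i \<Rightarrow> complex) \<Rightarrow> complex"
  assumes Lm_add: "bounded (range u) \<Longrightarrow> bounded (range v) \<Longrightarrow> Lm (\<lambda>i. u i + v i) = Lm u + Lm v"
    and Lm_mult: "bounded (range u) \<Longrightarrow> Lm (\<lambda>i. c * u i) = c * Lm u"
    and Lm_bound: "(\<And>i. cmod (u i) \<le> K) \<Longrightarrow> cmod (Lm u) \<le> K"
    and Lm_tendsto: "bounded (range u) \<Longrightarrow> (u \<longlongrightarrow> l) F \<Longrightarrow> Lm u = l"
begin

lemma Lm_diff:
  assumes "bounded (range u)" "bounded (range v)"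
  shows "Lm (\<lambda>i. u i - v i) = Lm u - Lm v"
proof -
  have "bounded (range (\<lambda>i. - 1 * v i))"
    using bounded_linear_image[OF assms(2) bounded_linear_mult_right[of "- 1"]]
    by (simp add: image_image)
  from Lm_add[OF assms(1) this] Lm_mult[OF assms(2), of "- 1"] show ?thesis by simp
qed

end

lemma generalized_limit_exists:
  fixes F :: "'i filter"
  assumes "F \<noteq> bot"
  obtains Lm where "generalized_limit F Lm"
proof -
  obtain G where G: "G \<le> F" "G \<noteq> bot"
    "\<And>u :: 'i \<Rightarrow> complex. bounded (range u) \<Longrightarrow> \<exists>l. (u \<longlongrightarrow> l) G"
    using assms by (rule convergent_refinement) blast
  have lim: "(u \<longlongrightarrow> Lim G u) G" if "bounded (range u)" for u :: "'i \<Rightarrow> complex"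
    using G(3)[OF that] tendsto_Lim[OF G(2)] by metis
  have "generalized_limit F (Lim G)"
  proof
    fix u v :: "'i \<Rightarrow> complex" and K c l
    show "Lim G (\<lambda>i. u i + v i) = Lim G u + Lim G v" if "bounded (range u)" "bounded (range v)"
      by (rule tendsto_Lim[OF G(2)]) (intro tendsto_add lim that)
    show "Lim G (\<lambda>i. c * u i) = c * Lim G u" if "bounded (range u)"
      by (rule tendsto_Lim[OF G(2)]) (intro tendsto_mult_left lim that)
    show "Lim G u = l" if "(u \<longlongrightarrow> l) F"
      by (rule tendsto_Lim[OF G(2)]) (rule tendsto_mono[OF G(1) that])
    show "cmod (Lim G u) \<le> K" if "\<And>i. cmod (u i) \<le> K"
      by (rule Lim_norm_ubound[OF G(2) lim]) (use that in \<open>auto intro: boundedI\<close>)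
  qed
  then show thesis by (rule that)
qed

section \<open>Adjoints of compact operators\<close>

definition adjoint :: "('a::complex_banach, 'b::complex_banach) cblinfun \<Rightarrow> ('b dual, 'a dual) cblinfun"
  where "adjoint T = (SOME U. \<forall>f. cblinfun_apply U f = cblinfun_compose f T)"

lemma adjoint_apply:
  fixes T :: "('a::complex_banach, 'b::complex_banach) cblinfun"
  shows "cblinfun_apply (adjoint T) f = cblinfun_compose f T"
proof -
  obtain U where "cblinfun_apply U = (\<lambda>f :: 'b dual. cblinfun_compose f T)"
    by (rule cblinfun_exists[where f = "\<lambda>f :: 'b dual. cblinfun_compose f T" and C = "norm T"])
      (simp_all add: cblinfun_compose_add_left cblinfun_compose_scaleC_left norm_cblinfun_compose
        mult.commute[of "norm T"])
  then have "\<exists>U. \<forall>f :: 'b dual. cblinfun_apply U f = cblinfun_compose f T"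
    by (intro exI[of _ U]) simp
  then show ?thesis unfolding adjoint_def by (rule someI2_ex) blast
qed

lemma compact_operator_net:
  assumes "compact_operator T" "0 < e"
  obtains Y where "finite Y" "\<And>x. norm x \<le> 1 \<Longrightarrow> \<exists>y\<in>Y. norm (cblinfun_apply T x - y) < e"
proof -
  obtain K where K: "compact K" "\<And>x. norm x \<le> 1 \<Longrightarrow> cblinfun_apply T x \<in> K"
    using assms(1) by (rule compact_operatorE) blast
  then obtain Y where "finite Y" "K \<subseteq> (\<Union>y\<in>Y. ball y e)"
    unfolding compact_eq_totally_bounded using assms(2) by blast
  then show thesis
    using K(2) by (intro that[of Y]) (force simp: dist_norm norm_minus_commute subset_iff)+
qed

text \<open>
  Schauder's theorem. The image of the dual ball is itself compact: a filter on it lifts to the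
  ball, where it may be assumed to converge pointwise.
\<close>

lemma compact_operator_adjoint:
  fixes T :: "('a::complex_banach, 'b::complex_banach) cblinfun"
  assumes T: "compact_operator T"
  shows "compact_operator (adjoint T)"
proof -
  define K where "K = cblinfun_apply (adjoint T) ` cball 0 1"
  have "compact K"
    unfolding compact_filter
  proof (intro allI impI)
    fix F :: "'a dual filter"
    assume F: "F \<noteq> bot" and FK: "\<forall>\<^sub>F g in F. g \<in> K"
    define s where "s g = (if g \<in> K then SOME f. norm f \<le> 1 \<and> cblinfun_compose f T = g else 0)"
      for g
    have s: "norm (s g) \<le> 1 \<and> cblinfun_compose (s g) T = g" if "g \<in> K" for g
    proof -
      have "\<exists>f. norm f \<le> 1 \<and> cblinfun_compose f T = g"
        using that by (auto simp: K_def adjoint_apply)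
      then show ?thesis using someI_ex[of "\<lambda>f. norm f \<le> 1 \<and> cblinfun_compose f T = g"] that
        by (simp add: s_def)
    qed
    have s1: "norm (s g) \<le> 1" for g using s by (cases "g \<in> K") (auto simp: s_def)
    have sb: "cmod (cblinfun_apply (s g) y) \<le> norm y" for g y
      using norm_cblinfun_apply[of "s g" y] mult_right_mono[OF s1, of "norm y" g] by simp
    obtain G where G: "G \<le> F" "G \<noteq> bot"
      "\<And>u :: 'a dual \<Rightarrow> complex. bounded (range u) \<Longrightarrow> \<exists>l. (u \<longlongrightarrow> l) G"
      using F by (rule convergent_refinement) blast
    have "\<exists>l. ((\<lambda>g. cblinfun_apply (s g) y) \<longlongrightarrow> l) G" for y
      by (rule G(3)) (use sb in \<open>auto intro!: boundedI\<close>)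
    then obtain L where L: "\<And>y. ((\<lambda>g. cblinfun_apply (s g) y) \<longlongrightarrow> L y) G" by metis
    have "L (x + y) = L x + L y" for x y
      using tendsto_unique[OF G(2) L] tendsto_add[OF L L] by fastforce
    moreover have "L (c *\<^sub>C x) = c *\<^sub>C L x" for c x
      using tendsto_unique[OF G(2) L] tendsto_mult_left[OF L] by (fastforce simp: scaleC_complex_def)
    moreover have Lb: "norm (L x) \<le> 1 * norm x" for x
      using Lim_norm_ubound[OF G(2) L] sb by auto
    ultimately obtain f :: "'b dual" where f: "cblinfun_apply f = L" by (rule cblinfun_exists)
    have f1: "norm f \<le> 1" by (rule norm_cblinfun_bound) (use Lb f in auto)
    define g0 where "g0 = cblinfun_compose f T"
    have "g0 \<in> K" using f1 by (auto simp: K_def g0_def adjoint_apply)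
    \<comment> \<open>Pointwise convergence of the functionals is uniform on the totally bounded image of \<open>T\<close>.\<close>
    have "((\<lambda>g. g) \<longlongrightarrow> g0) G"
      unfolding tendsto_iff dist_norm
    proof (intro allI impI)
      fix e :: real assume e: "0 < e"
      obtain Y where Y: "finite Y" "\<And>x. norm x \<le> 1 \<Longrightarrow> \<exists>y\<in>Y. norm (cblinfun_apply T x - y) < e / 4"
        using compact_operator_net[OF T, of "e / 4"] e by auto
      have "\<forall>\<^sub>F g in G. \<forall>y\<in>Y. cmod (cblinfun_apply (s g) y - L y) < e / 4"
        using Y(1) tendstoD[OF L, of "e / 4"] e by (intro eventually_ball_finite) (auto simp: dist_norm)
      moreover have "\<forall>\<^sub>F g in G. g \<in> K" using FK G(1) by (rule filter_leD[rotated])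
      ultimately show "\<forall>\<^sub>F g in G. norm (g - g0) < e"
      proof eventually_elim
        case (elim g)
        have "norm (g - g0) \<le> 3 * e / 4"
        proof (rule norm_cblinfun_bound_ball)
          fix x :: 'a assume "norm x \<le> 1"
          then obtain y where y: "y \<in> Y" "norm (cblinfun_apply T x - y) < e / 4" using Y(2) by blast
          have "cblinfun_apply (g - g0) x
              = cblinfun_apply (s g) (cblinfun_apply T x) - cblinfun_apply f (cblinfun_apply T x)"
            using s[OF elim(2)] by (metis cblinfun_arith_apply(2,6) g0_def)
          also have "\<dots> = cblinfun_apply (s g) (cblinfun_apply T x - y)
              - cblinfun_apply f (cblinfun_apply T x - y) + (cblinfun_apply (s g) y - L y)"
            by (simp add: f[symmetric])
          finally have "norm (cblinfun_apply (g - g0) x) \<le> norm (cblinfun_apply T x - y)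
              + norm (cblinfun_apply T x - y) + cmod (cblinfun_apply (s g) y - L y)"
            using sb[of g "cblinfun_apply T x - y"] Lb[of "cblinfun_apply T x - y"]
            by (smt (verit) f mult_1 norm_triangle_ineq norm_triangle_ineq4)
          then show "norm (cblinfun_apply (g - g0) x) \<le> 3 * e / 4"
            using y elim(1) by fastforce
        qed (use e in simp)
        then show ?case using e by simp
      qed
    qed
    then have "G \<le> nhds g0" by (simp add: filterlim_def filtermap_ident)
    then have "inf (nhds g0) F \<noteq> bot" using G(1,2) by (metis bot.extremum_uniqueI le_inf_iff)
    then show "\<exists>g\<in>K. inf (nhds g) F \<noteq> bot" using \<open>g0 \<in> K\<close> by blast
  qed
  then show ?thesis by (rule compact_operatorI) (simp add: K_def)
qed

lemma cblinfun_apply_sum: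
  "cblinfun_apply f (\<Sum>i\<in>I. x i) = (\<Sum>i\<in>I. cblinfun_apply f (x i))"
  by (induction I rule: infinite_finite_induct) simp_all

lemma sum_cblinfun_apply:
  "cblinfun_apply (\<Sum>i\<in>I. f i) x = (\<Sum>i\<in>I. cblinfun_apply (f i) x)"
  by (induction I rule: infinite_finite_induct) simp_all

text \<open>The first-order condition at the minimum of a quadratic function.\<close>

lemma linear_coeff_nonneg:
  fixes R D :: real
  assumes "0 \<le> D" "\<And>t. 0 < t \<Longrightarrow> t \<le> 1 \<Longrightarrow> 0 \<le> 2 * t * R + t\<^sup>2 * D"
  shows "0 \<le> R"
proof (rule ccontr)
  assume "\<not> 0 \<le> R"
  then have R: "R < 0" by simp
  define t where "t = min 1 (- R / (D + 1))"
  have t: "0 < t" "t \<le> 1" using R assms(1) by (auto simp: t_def divide_neg_pos)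
  have "t \<le> - R / (D + 1)" by (simp add: t_def)
  then have "t * (D + 1) \<le> - R" using assms(1) pos_le_divide_eq[of "D + 1" t "- R"] by simp
  then have "t * D < - R" using t by (simp add: algebra_simps)
  then have "2 * R + t * D < 0" using R by simp
  then have "t * (2 * R + t * D) < 0" using t(1) by (simp add: mult_pos_neg)
  then show False using assms(2)[OF t] by (simp add: algebra_simps power2_eq_square)
qed

text \<open>
  The second adjoint of a compact operator takes its values in the original space. As the closure
  \<open>K\<close> of \<open>T(ball)\<close> is compact, it is enough to match the values of \<open>\<phi>\<close> on finitely many
  functionals \<open>f\<close>. Let \<open>k\<close> be the point of \<open>K\<close> at which the sum of the squared deviations
  \<open>\<bar>f k - \<phi> (f \<circ> T)\<bar>\<^sup>2\<close> is least. If the minimum were positive, the first-order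
  condition would make \<open>k\<close> a maximum on \<open>K\<close> of the real part of a combination \<open>g\<close> of the
  functionals, with \<open>Re (\<phi> (g \<circ> T)) > Re (g k)\<close>. As \<open>T(ball)\<close> is balanced, this maximum is
  the norm of \<open>g \<circ> T\<close>, in contradiction to \<open>norm \<phi> \<le> 1\<close>.
\<close>

lemma compact_bidual_value:
  fixes T :: "('a::complex_banach, 'b::complex_banach) cblinfun" and \<phi> :: "'a dual dual"
  assumes T: "compact_operator T" and \<phi>: "norm \<phi> \<le> 1"
  obtains v where "v \<in> closure (cblinfun_apply T ` cball 0 1)"
    "\<And>f :: 'b dual. cblinfun_apply f v = cblinfun_apply \<phi> (cblinfun_compose f T)"
proof -
  define K where "K = closure (cblinfun_apply T ` cball 0 1)"
  define \<psi> where "\<psi> = cblinfun_compose \<phi> (adjoint T)"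
  have \<psi>: "cblinfun_apply \<psi> f = cblinfun_apply \<phi> (cblinfun_compose f T)" for f
    by (simp add: \<psi>_def adjoint_apply)
  have K: "compact K" using T by (simp add: K_def compact_operator_def)
  have convK: "convex K"
    unfolding K_def by (intro convex_closure convex_linear_image convex_cball)
      (simp add: bounded_linear.linear bounded_linear_cblinfun_apply)
  have "cblinfun_apply T 0 \<in> K" unfolding K_def by (intro subsetD[OF closure_subset] imageI) simp
  then have ne: "K \<noteq> {}" by blast
  have fin: "\<exists>v\<in>K. \<forall>f\<in>S. cblinfun_apply f v = cblinfun_apply \<psi> f" if S: "finite S" for S :: "'b dual set"
  proof -
    define a where "a v f = cblinfun_apply f v - cblinfun_apply \<psi> f" for v and f :: "'b dual"
    have "continuous_on K (\<lambda>v. \<Sum>f\<in>S. (cmod (a v f))\<^sup>2)"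
      unfolding a_def
      by (intro continuous_intros linear_continuous_on bounded_linear_cblinfun_apply)
    then obtain k where k: "k \<in> K" "\<And>v. v \<in> K \<Longrightarrow> (\<Sum>f\<in>S. (cmod (a k f))\<^sup>2) \<le> (\<Sum>f\<in>S. (cmod (a v f))\<^sup>2)"
      using continuous_attains_inf[OF K ne] by blast
    \<comment> \<open>Up to a factor, the gradient of the sum of squares at \<open>k\<close> with reversed sign.\<close>
    define g where "g = (\<Sum>f\<in>S. (- cnj (a k f)) *\<^sub>C f)"
    have g: "cblinfun_apply g v = - (\<Sum>f\<in>S. cnj (a k f) * cblinfun_apply f v)" for v
      by (simp add: g_def sum_cblinfun_apply scaleC_complex_def sum_negf)
    have max: "Re (cblinfun_apply g v) \<le> Re (cblinfun_apply g k)" if v: "v \<in> K" for v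
    proof -
      define d where "d f = cblinfun_apply f (v - k)" for f :: "'b dual"
      define R where "R = (\<Sum>f\<in>S. Re (cnj (a k f) * d f))"
      define D where "D = (\<Sum>f\<in>S. (cmod (d f))\<^sup>2)"
      have "0 \<le> R"
      proof (rule linear_coeff_nonneg)
        show "0 \<le> D" by (simp add: D_def sum_nonneg)
        fix t :: real assume t: "0 < t" "t \<le> 1"
        have "(1 - t) *\<^sub>R k + t *\<^sub>R v \<in> K" using convexD_alt[OF convK k(1) v, of t] t by simp
        moreover have "(1 - t) *\<^sub>R k + t *\<^sub>R v = k + t *\<^sub>R (v - k)" by (simp add: algebra_simps)
        ultimately have "(\<Sum>f\<in>S. (cmod (a k f))\<^sup>2) \<le> (\<Sum>f\<in>S. (cmod (a (k + t *\<^sub>R (v - k)) f))\<^sup>2)"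
          using k(2) by metis
        moreover have "a (k + t *\<^sub>R (v - k)) f = a k f + of_real t * d f" for f
          by (simp add: a_def d_def scaleR_conv_of_real algebra_simps)
        moreover have "(cmod (p + of_real t * q))\<^sup>2
            = (cmod p)\<^sup>2 + 2 * t * Re (cnj p * q) + t\<^sup>2 * (cmod q)\<^sup>2" for p q
          unfolding cmod_power2 by (simp add: algebra_simps power2_eq_square)
        ultimately show "0 \<le> 2 * t * R + t\<^sup>2 * D"
          by (simp add: sum.distrib R_def D_def sum_distrib_left distrib_left)
      qed
      moreover have "R = Re (cblinfun_apply g k) - Re (cblinfun_apply g v)"
        by (simp add: R_def g d_def sum_subtractf algebra_simps)
      ultimately show ?thesis by simp
    qed
    have "norm (cblinfun_compose g T) \<le> Re (cblinfun_apply g k)"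
    proof (rule norm_cblinfun_bound_ball)
      have TK: "cblinfun_apply T x \<in> K" if "norm x \<le> 1" for x
        unfolding K_def using that by (intro subsetD[OF closure_subset]) auto
      show "0 \<le> Re (cblinfun_apply g k)" using max[OF TK[of 0]] by simp
      fix x :: 'a assume x: "norm x \<le> 1"
      define z where "z = cblinfun_apply g (cblinfun_apply T x)"
      \<comment> \<open>A unimodular factor that rotates \<open>z\<close> onto the positive real axis.\<close>
      define c where "c = (if z = 0 then 1 else cnj z / cmod z)"
      have "cmod c = 1" by (simp add: c_def norm_divide)
      then have "norm (c *\<^sub>C x) \<le> 1" using x by (simp add: norm_scaleC)
      from max[OF TK[OF this]] have "Re (c * z) \<le> Re (cblinfun_apply g k)"
        by (simp add: z_def scaleC_complex_def del: times_complex.sel)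
      moreover have "c * z = cmod z"
        using complex_norm_square[of z]
        by (simp add: c_def power2_eq_square mult.commute divide_eq_eq)
      ultimately show "norm (cblinfun_apply (cblinfun_compose g T) x) \<le> Re (cblinfun_apply g k)"
        by (simp add: z_def del: times_complex.sel)
    qed
    moreover have "cmod (cblinfun_apply \<psi> g) \<le> norm (cblinfun_compose g T)"
      using norm_cblinfun_apply[of \<phi> "cblinfun_compose g T"]
        mult_right_mono[OF \<phi>, of "norm (cblinfun_compose g T)"] by (simp add: \<psi>)
    ultimately have "Re (cblinfun_apply \<psi> g - cblinfun_apply g k) \<le> 0"
      using complex_Re_le_cmod[of "cblinfun_apply \<psi> g"] by simp
    also have "cblinfun_apply \<psi> g - cblinfun_apply g k = (\<Sum>f\<in>S. cnj (a k f) * a k f)"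
      unfolding g by (simp add: g_def cblinfun_apply_sum scaleC_complex_def sum_negf a_def
          sum_subtractf sum.distrib algebra_simps)
    also have "Re \<dots> = (\<Sum>f\<in>S. (cmod (a k f))\<^sup>2)"
      unfolding cmod_power2 by (simp add: power2_eq_square)
    finally have "(\<Sum>f\<in>S. (cmod (a k f))\<^sup>2) = 0" by (simp add: antisym sum_nonneg)
    then have "\<forall>f\<in>S. a k f = 0" using S by (simp add: sum_nonneg_eq_0_iff)
    then show ?thesis using k(1) by (auto simp: a_def)
  qed
  have "K \<inter> (\<Inter>f\<in>UNIV. {v. cblinfun_apply f v = cblinfun_apply \<psi> f}) \<noteq> {}"
  proof (rule compact_imp_fip_image[OF K])
    fix f :: "'b dual"
    show "closed {v. cblinfun_apply f v = cblinfun_apply \<psi> f}"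
      by (intro closed_Collect_eq continuous_intros linear_continuous_on bounded_linear_cblinfun_apply)
  next
    fix S :: "'b dual set" assume "finite S"
    then show "K \<inter> (\<Inter>f\<in>S. {v. cblinfun_apply f v = cblinfun_apply \<psi> f}) \<noteq> {}"
      using fin[of S] by auto
  qed
  then show thesis using that by (auto simp: K_def \<psi>)
qed

text \<open>
  Every bounded operator composed with the adjoint of a compact one is again such an adjoint:
  \<open>V x\<close> is the value of the second adjoint of \<open>T\<close> at the functional \<open>g \<mapsto> (S g) x\<close>.
\<close>

lemma compose_adjoint_compact:
  fixes T :: "('a::complex_banach, 'b::complex_banach) cblinfun"
    and S :: "('a dual, 'c::complex_banach dual) cblinfun"
  assumes T: "compact_operator T"
  obtains V :: "('c, 'b) cblinfun" where "compact_operator V" "norm V \<le> norm S * norm T"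
    "\<And>f :: 'b dual. cblinfun_compose f V = cblinfun_apply S (cblinfun_compose f T)"
proof -
  \<comment> \<open>Positive also for \<open>S = 0\<close>, so that functionals can be scaled into the unit ball.\<close>
  define r where "r = norm S + 1"
  have r: "0 < r" by (simp add: r_def add_nonneg_pos)
  have Sb: "cmod (cblinfun_apply (cblinfun_apply S g) x) \<le> norm S * norm g * norm x" for g x
    using norm_cblinfun_apply[of "cblinfun_apply S g" x]
      mult_right_mono[OF norm_cblinfun_apply[of S g], of "norm x"] by simp
  have ball: "\<exists>v. v \<in> (\<lambda>v. r *\<^sub>R v) ` closure (cblinfun_apply T ` cball 0 1) \<and>
      (\<forall>f :: 'b dual. cblinfun_apply f v = cblinfun_apply (cblinfun_apply S (cblinfun_compose f T)) x)"
    if x: "norm x \<le> 1" for x :: 'c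
  proof -
    have "cmod (cblinfun_apply (cblinfun_apply S g) x / r) \<le> 1 * norm g" for g
    proof -
      have "norm S * norm g * norm x \<le> r * norm g * 1"
        using x by (intro mult_mono) (auto simp: r_def)
      then show ?thesis using Sb[of g x] r by (simp add: norm_divide divide_le_eq mult.commute)
    qed
    note bound = this
    obtain \<phi> :: "'a dual dual" where \<phi>: "cblinfun_apply \<phi> = (\<lambda>g. cblinfun_apply (cblinfun_apply S g) x / r)"
      by (rule cblinfun_exists[OF _ _ bound]) (simp_all add: scaleC_complex_def add_divide_distrib)
    have "norm \<phi> \<le> 1" by (rule norm_cblinfun_bound) (use bound in \<open>auto simp: \<phi>\<close>)
    then obtain v where v: "v \<in> closure (cblinfun_apply T ` cball 0 1)"
      "\<And>f :: 'b dual. cblinfun_apply f v = cblinfun_apply \<phi> (cblinfun_compose f T)"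
      using compact_bidual_value[OF T] by blast
    then show ?thesis using r
      by (intro exI[of _ "r *\<^sub>R v"]) (auto simp: \<phi> scaleR_conv_of_real)
  qed
  have "\<exists>v. \<forall>f :: 'b dual. cblinfun_apply f v = cblinfun_apply (cblinfun_apply S (cblinfun_compose f T)) x"
    for x :: 'c
  proof (cases "x = 0")
    case True
    then show ?thesis by (intro exI[of _ 0]) simp
  next
    case False
    have "\<exists>v. \<forall>f :: 'b dual. cblinfun_apply f v
        = cblinfun_apply (cblinfun_apply S (cblinfun_compose f T)) (x /\<^sub>R norm x)"
    proof -
      have "norm (x /\<^sub>R norm x) \<le> 1" using False by simp
      from ball[OF this] show ?thesis by blast
    qed
    then obtain v where "\<forall>f :: 'b dual. cblinfun_apply f v
        = cblinfun_apply (cblinfun_apply S (cblinfun_compose f T)) (x /\<^sub>R norm x)"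
      by blast
    then show ?thesis using False by (intro exI[of _ "norm x *\<^sub>R v"]) simp
  qed
  then obtain V0 where V0: "\<And>x (f :: 'b dual). cblinfun_apply f (V0 x)
      = cblinfun_apply (cblinfun_apply S (cblinfun_compose f T)) x" by metis
  have V0b: "norm (V0 x) \<le> (norm S * norm T) * norm x" for x
  proof -
    obtain f :: "'b dual" where f: "norm f \<le> 1" "cblinfun_apply f (V0 x) = complex_of_real (norm (V0 x))"
      by (rule norming_functional)
    have "norm (V0 x) \<le> norm S * norm (cblinfun_compose f T) * norm x"
      using Sb[of "cblinfun_compose f T" x] arg_cong[OF f(2), of cmod] by (simp add: V0)
    also have "\<dots> \<le> norm S * (1 * norm T) * norm x"
      using order_trans[OF norm_cblinfun_compose mult_right_mono[OF f(1) norm_ge_zero]]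
      by (intro mult_right_mono mult_left_mono) auto
    finally show ?thesis by simp
  qed
  obtain V where V: "cblinfun_apply V = V0"
    by (rule cblinfun_exists[OF _ _ V0b]) (rule functionals_separate, simp add: V0)+
  show thesis
  proof (rule that)
    show "cblinfun_compose f V = cblinfun_apply S (cblinfun_compose f T)" for f :: "'b dual"
      by (rule cblinfun_eqI) (simp add: V V0)
    show "norm V \<le> norm S * norm T" by (rule norm_cblinfun_bound) (use V0b in \<open>auto simp: V\<close>)
    have "compact ((\<lambda>v. r *\<^sub>R v) ` closure (cblinfun_apply T ` cball 0 1))"
      using T by (intro compact_scaling) (simp add: compact_operator_def)
    then show "compact_operator V"
    proof (rule compact_operatorI, safe)
      fix x :: 'c assume "x \<in> cball 0 1"
      then obtain v where v: "v \<in> (\<lambda>v. r *\<^sub>R v) ` closure (cblinfun_apply T ` cball 0 1)"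
        "\<And>f :: 'b dual. cblinfun_apply f v = cblinfun_apply (cblinfun_apply S (cblinfun_compose f T)) x"
        using ball[of x] unfolding mem_cball_0 by blast
      have "cblinfun_apply V x = v" by (rule functionals_separate) (simp add: V V0 v(2))
      then show "cblinfun_apply V x \<in> (\<lambda>v. r *\<^sub>R v) ` closure (cblinfun_apply T ` cball 0 1)"
        using v(1) by simp
    qed
  qed
qed

section \<open>Amenability tested on bimodules that are whole types\<close>

locale bimodule_type =
  fixes l :: "'a::complex_banach_algebra \<Rightarrow> 'y::complex_banach \<Rightarrow> 'y"
    and r :: "'y \<Rightarrow> 'a \<Rightarrow> 'y"
    and C :: real
  assumes l_add_right: "l a (x + y) = l a x + l a y"
    and l_scaleC_right: "l a (c *\<^sub>C x) = c *\<^sub>C l a x"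
    and l_add_left: "l (a + b) x = l a x + l b x"
    and l_scaleC_left: "l (c *\<^sub>C a) x = c *\<^sub>C l a x"
    and r_add_left: "r (x + y) a = r x a + r y a"
    and r_scaleC_left: "r (c *\<^sub>C x) a = c *\<^sub>C r x a"
    and r_add_right: "r x (a + b) = r x a + r x b"
    and r_scaleC_right: "r x (c *\<^sub>C a) = c *\<^sub>C r x a"
    and l_mult: "l (a * b) x = l a (l b x)"
    and r_mult: "r x (a * b) = r (r x a) b"
    and l_r: "l a (r x b) = r (l a x) b"
    and l_bound: "norm (l a x) \<le> C * norm a * norm x"
    and r_bound: "norm (r x a) \<le> C * norm a * norm x"
begin

text \<open>
  Amenability is tested on bimodules whose points lie in a fixed type; an injection \<open>g\<close> into that
  type transports a bimodule there.
\<close>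

definition encode :: "('y \<Rightarrow> 'z) \<Rightarrow> ('a, 'z) bimodule" where
  "encode g = \<lparr>points = range g, vzero = g 0, vadd = (\<lambda>u v. g (inv g u + inv g v)),
    vscale = (\<lambda>c u. g (c *\<^sub>C inv g u)), vnorm = (\<lambda>u. norm (inv g u)),
    lact = (\<lambda>a u. g (l a (inv g u))), ract = (\<lambda>u a. g (r (inv g u) a))\<rparr>"

lemma encode_mcomplete:
  fixes g :: "'y \<Rightarrow> 'z"
  assumes g: "inj g"
  shows "Metric_space.mcomplete (range g) (\<lambda>u v. norm (inv g u - inv g v))"
proof -
  define d where "d u v = norm (inv g u - inv g v)" for u v
  interpret Metric_space "range g" d
    by unfold_locales
      (use g in \<open>auto simp: d_def dist_norm[symmetric] dist_commute dist_triangle\<close>)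
  have "\<exists>u. limitin mtopology \<sigma> u sequentially" if "MCauchy \<sigma>" for \<sigma>
  proof -
    have \<sigma>: "range \<sigma> \<subseteq> range g" "Cauchy (\<lambda>n. inv g (\<sigma> n))"
      using that by (auto simp: MCauchy_def Cauchy_def d_def dist_norm)
    then obtain y where y: "(\<lambda>n. inv g (\<sigma> n)) \<longlonglongrightarrow> y"
      using Cauchy_convergent_iff convergent_def by blast
    have "limitin mtopology \<sigma> (g y) sequentially"
      unfolding limitin_metric
      using \<sigma>(1) tendstoD[OF y] g by (auto simp: d_def dist_norm image_subset_iff)
    then show ?thesis by blast
  qed
  then have "mcomplete" by (simp add: mcomplete_def)
  then show ?thesis by (simp add: d_def[abs_def])
qed

lemma encode_banach_bimodule:
  fixes g :: "'y \<Rightarrow> 'z"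
  assumes g: "inj g"
  shows "banach_bimodule (encode g)"
proof -
  have diff: "vdiff (encode g) u v = g (inv g u - inv g v)" for u v
    using g scaleR_scaleC[of "-1" "inv g v"] by (simp add: vdiff_def encode_def)
  show ?thesis
  proof
    show "Metric_space.mcomplete (points (encode g)) (\<lambda>x y. vnorm (encode g) (vdiff (encode g) x y))"
      unfolding diff using encode_mcomplete[OF g] g by (simp add: encode_def)
    show "\<exists>K. \<forall>a. \<forall>x\<in>points (encode g). vnorm (encode g) (lact (encode g) a x)
        \<le> K * norm a * vnorm (encode g) x"
      using l_bound g by (auto simp: encode_def)
    show "\<exists>K. \<forall>a. \<forall>x\<in>points (encode g). vnorm (encode g) (ract (encode g) x a)
        \<le> K * norm a * vnorm (encode g) x"
      using r_bound g by (auto simp: encode_def)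
  qed (use g in \<open>auto simp: diff, simp_all add: encode_def f_inv_into_f add_ac scaleC_add_right
      scaleC_add_left scaleC_scaleC scaleC_one norm_scaleC norm_triangle_ineq
      l_add_right l_scaleC_right l_add_left l_scaleC_left r_add_left r_scaleC_left r_add_right
      r_scaleC_right l_mult r_mult l_r, metis f_inv_into_f\<close>)
qed

lemma derivation_inner:
  fixes g :: "'y \<Rightarrow> 'z" and \<delta> :: "'a \<Rightarrow> 'y dual"
  assumes am: "amenable_on TYPE('z) TYPE('a)" and g: "inj g"
    and \<delta>_add: "\<And>a b. \<delta> (a + b) = \<delta> a + \<delta> b"
    and \<delta>_scaleC: "\<And>c a. \<delta> (c *\<^sub>C a) = c *\<^sub>C \<delta> a"
    and \<delta>_bound: "\<And>a. norm (\<delta> a) \<le> K * norm a"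
    and \<delta>_mult: "\<And>a b y. cblinfun_apply (\<delta> (a * b)) y
      = cblinfun_apply (\<delta> b) (r y a) + cblinfun_apply (\<delta> a) (l b y)"
  obtains M :: "'y dual"
    where "\<And>a y. cblinfun_apply (\<delta> a) y = cblinfun_apply M (r y a) - cblinfun_apply M (l a y)"
proof -
  define D where "D a = (\<lambda>u\<in>range g. cblinfun_apply (\<delta> a) (inv g u))" for a
  have ig: "inv g (g y) = y" for y using g by simp
  have pts: "D a \<in> points (dual_bimodule (encode g))" for a
  proof -
    have "cmod (cblinfun_apply (\<delta> a) y) \<le> norm (\<delta> a) * norm y" for y
      by (rule norm_cblinfun_apply)
    then show ?thesis
      by (auto simp: dual_bimodule_def encode_def D_def ig scaleC_complex_def)
  qed
  have bd: "vnorm (dual_bimodule (encode g)) (D a) \<le> K * norm a" for a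
  proof -
    have "cmod (D a u) \<le> K * norm a" if "u \<in> range g" "norm (inv g u) \<le> 1" for u
    proof -
      have "cmod (D a u) \<le> norm (\<delta> a) * norm (inv g u)"
        using that(1) norm_cblinfun_apply[of "\<delta> a"] by (simp add: D_def)
      also have "\<dots> \<le> norm (\<delta> a) * 1" by (rule mult_left_mono) (use that in auto)
      finally show ?thesis using \<delta>_bound[of a] by simp
    qed
    moreover have "g 0 \<in> {u \<in> range g. norm (inv g u) \<le> 1}" by (simp add: ig)
    ultimately show ?thesis
      unfolding dual_bimodule_def encode_def by simp (rule cSUP_least, blast, simp)
  qed
  have "continuous_derivation (dual_bimodule (encode g)) D"
    unfolding continuous_derivation_def
  proof (intro conjI allI)
    show "\<exists>C. \<forall>a. vnorm (dual_bimodule (encode g)) (D a) \<le> C * norm a" using bd by blast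
  qed (use pts in \<open>auto simp: dual_bimodule_def encode_def D_def ig \<delta>_add \<delta>_scaleC \<delta>_mult scaleC_complex_def
        intro!: restrict_ext\<close>)
  then have "inner_derivation (dual_bimodule (encode g)) D"
    using am encode_banach_bimodule[OF g] unfolding amenable_on_def by blast
  then obtain f where f: "f \<in> points (dual_bimodule (encode g))"
    "\<And>a. D a = vdiff (dual_bimodule (encode g)) (lact (dual_bimodule (encode g)) a f)
        (ract (dual_bimodule (encode g)) f a)"
    unfolding inner_derivation_def by blast
  have "\<exists>B. \<forall>u\<in>range g. cmod (f u) \<le> B * norm (inv g u)"
    using f(1) by (simp add: dual_bimodule_def encode_def)
  then obtain B where B: "\<And>u. u \<in> range g \<Longrightarrow> cmod (f u) \<le> B * norm (inv g u)"
    by blast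
  have "f (g (x + y)) = f (g x) + f (g y)" "f (g (c *\<^sub>C x)) = c *\<^sub>C f (g x)" for x y c
    using f(1) by (auto simp: dual_bimodule_def encode_def ig scaleC_complex_def)
  moreover have "norm (f (g x)) \<le> B * norm x" for x using B[of "g x"] by (simp add: ig)
  ultimately obtain M :: "'y dual" where M: "cblinfun_apply M = (\<lambda>y. f (g y))"
    using cblinfun_exists[of "\<lambda>y. f (g y)"] by blast
  have "cblinfun_apply (\<delta> a) y = cblinfun_apply M (r y a) - cblinfun_apply M (l a y)" for a y
    using fun_cong[OF f(2)[of a], of "g y"]
    by (simp add: vdiff_def dual_bimodule_def encode_def D_def ig M)
  then show thesis by (rule that)
qed

end

section \<open>The universal derivation\<close>

instantiation prod :: (complex_banach, complex_banach) complex_banach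
begin

definition scaleC_prod :: "complex \<Rightarrow> 'a \<times> 'b \<Rightarrow> 'a \<times> 'b" where
  "scaleC_prod c x = (c *\<^sub>C fst x, c *\<^sub>C snd x)"

instance
proof
  fix c :: complex and x :: "'a \<times> 'b"
  have "norm (c *\<^sub>C x) = sqrt ((cmod c)\<^sup>2 * ((norm (fst x))\<^sup>2 + (norm (snd x))\<^sup>2))"
    by (simp add: scaleC_prod_def norm_prod_def norm_scaleC power_mult_distrib distrib_left)
  then show "norm (c *\<^sub>C x) = cmod c * norm x"
    by (simp add: real_sqrt_mult norm_prod_def)
qed (simp_all add: scaleC_prod_def prod_eq_iff scaleC_add_right scaleC_add_left scaleC_scaleC
    scaleR_scaleC)

end

lemma fst_scaleC [simp]: "fst (c *\<^sub>C x) = c *\<^sub>C fst x"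
  and snd_scaleC [simp]: "snd (c *\<^sub>C x) = c *\<^sub>C snd x"
  by (simp_all add: scaleC_prod_def)

lemma cblinfun_apply_Pair_0:
  "cblinfun_apply f (x + y, 0) = cblinfun_apply f (x, 0) + cblinfun_apply f (y, 0)"
  "cblinfun_apply f (x - y, 0) = cblinfun_apply f (x, 0) - cblinfun_apply f (y, 0)"
  "cblinfun_apply f (c *\<^sub>C x, 0) = c *\<^sub>C cblinfun_apply f (x, 0)"
  by (simp_all add: scaleC_prod_def flip: cblinfun_apply_simps)

type_synonym ('a, 'b) bilinear_form = "('a, 'b dual) cblinfun"

definition bounded_form :: "real \<Rightarrow> ('a::complex_banach \<Rightarrow> 'b::complex_banach \<Rightarrow> complex) \<Rightarrow> bool" where
  "bounded_form K \<phi> \<longleftrightarrow>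
     (\<forall>x y b. \<phi> (x + y) b = \<phi> x b + \<phi> y b) \<and> (\<forall>c x b. \<phi> (c *\<^sub>C x) b = c * \<phi> x b) \<and>
     (\<forall>x a b. \<phi> x (a + b) = \<phi> x a + \<phi> x b) \<and> (\<forall>c x b. \<phi> x (c *\<^sub>C b) = c * \<phi> x b) \<and>
     0 \<le> K \<and> (\<forall>x b. cmod (\<phi> x b) \<le> K * norm x * norm b)"

definition form :: "('a::complex_banach \<Rightarrow> 'b::complex_banach \<Rightarrow> complex) \<Rightarrow> ('a, 'b) bilinear_form" where
  "form \<phi> = (SOME \<psi>. \<forall>x b. cblinfun_apply (cblinfun_apply \<psi> x) b = \<phi> x b)"

lemma form_eqI:
  fixes \<psi> \<psi>' :: "('a::complex_banach, 'b::complex_banach) bilinear_form"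
  assumes "\<And>x b. cblinfun_apply (cblinfun_apply \<psi> x) b = cblinfun_apply (cblinfun_apply \<psi>' x) b"
  shows "\<psi> = \<psi>'"
  using assms by (intro cblinfun_eqI)

lemma form_apply:
  fixes \<phi> :: "'a::complex_banach \<Rightarrow> 'b::complex_banach \<Rightarrow> complex"
  assumes "bounded_form K \<phi>"
  shows "cblinfun_apply (cblinfun_apply (form \<phi>) x) b = \<phi> x b"
proof -
  note \<phi> = assms[unfolded bounded_form_def]
  have "\<exists>f :: 'b dual. cblinfun_apply f = \<phi> x" for x
    using cblinfun_exists[of "\<phi> x" "K * norm x"] \<phi> by (metis scaleC_complex_def)
  then obtain f :: "'a \<Rightarrow> 'b dual" where f: "\<And>x. cblinfun_apply (f x) = \<phi> x" by metis
  have "norm (f x) \<le> K * norm x" for x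
    by (rule norm_cblinfun_bound) (use \<phi> in \<open>auto simp: f\<close>)
  moreover have "f (x + y) = f x + f y" "f (c *\<^sub>C x) = c *\<^sub>C f x" for x y c
    by (rule cblinfun_eqI, use \<phi> in \<open>simp add: f scaleC_complex_def\<close>)+
  ultimately obtain \<psi> where "cblinfun_apply \<psi> = f"
    using cblinfun_exists[of f K] by blast
  then have "\<exists>\<psi>. \<forall>x b. cblinfun_apply (cblinfun_apply \<psi> x) b = \<phi> x b"
    using f by (intro exI[of _ \<psi>]) simp
  then show ?thesis unfolding form_def by (rule someI2_ex) blast
qed

lemma norm_form_bound:
  fixes \<psi> :: "('a::complex_banach, 'b::complex_banach) bilinear_form"
  assumes "0 \<le> K" "\<And>x b. cmod (cblinfun_apply (cblinfun_apply \<psi> x) b) \<le> K * norm x * norm b"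
  shows "norm \<psi> \<le> K"
  using assms by (intro norm_cblinfun_bound) auto

lemma norm_form: "bounded_form K \<phi> \<Longrightarrow> norm (form \<phi>) \<le> K"
  by (rule norm_form_bound) (auto simp: form_apply, auto simp: bounded_form_def)

lemma form_apply_bound:
  fixes \<psi> :: "('a::complex_banach, 'b::complex_banach) bilinear_form"
  shows "cmod (cblinfun_apply (cblinfun_apply \<psi> x) b) \<le> norm \<psi> * norm x * norm b"
  using norm_cblinfun_apply[of "cblinfun_apply \<psi> x" b]
    mult_right_mono[OF norm_cblinfun_apply[of \<psi> x], of "norm b"] by simp

lemma norm_fst_snd_le: "norm (fst x) \<le> norm x" "norm (snd x) \<le> norm x"
  by (metis norm_fst_le prod.collapse, metis norm_snd_le prod.collapse)

text \<open>
  A pair \<open>(a, s)\<close> stands for the element \<open>a + s 1\<close> of the unitization. The products with an element of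
  the algebra lie in the algebra again.
\<close>

definition umul :: "'a::complex_banach_algebra \<times> complex \<Rightarrow> 'a \<Rightarrow> 'a" where
  "umul x b = fst x * b + snd x *\<^sub>C b"

definition lmul :: "'a::complex_banach_algebra \<Rightarrow> 'a \<times> complex \<Rightarrow> 'a" where
  "lmul a x = a * fst x + snd x *\<^sub>C a"

lemma umul_linear:
  "umul (x + y) b = umul x b + umul y b" "umul (c *\<^sub>C x) b = c *\<^sub>C umul x b"
  "umul x (a + b) = umul x a + umul x b" "umul x (c *\<^sub>C b) = c *\<^sub>C umul x b"
  by (simp_all add: umul_def algebra_simps scaleC_add_left scaleC_add_right mult_scaleC_left
      mult_scaleC_right scaleC_scaleC scaleC_complex_def)

lemma lmul_linear:
  "lmul a (x + y) = lmul a x + lmul a y" "lmul a (c *\<^sub>C x) = c *\<^sub>C lmul a x"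
  "lmul (a + b) x = lmul a x + lmul b x" "lmul (c *\<^sub>C a) x = c *\<^sub>C lmul a x"
  by (simp_all add: lmul_def algebra_simps scaleC_add_left scaleC_add_right mult_scaleC_left
      mult_scaleC_right scaleC_scaleC scaleC_complex_def)

lemma umul_mult: "umul x (a * b) = umul x a * b"
  and lmul_mult: "lmul (a * b) x = a * lmul b x"
  and lmul_times: "lmul a x * b = a * umul x b"
  and umul_0: "umul (a, 0) b = a * b" and lmul_0: "lmul a (b, 0) = a * b"
  and umul_1: "umul (0, 1) a = a" and lmul_1: "lmul a (0, 1) = a"
  by (simp_all add: umul_def lmul_def algebra_simps mult_scaleC_left mult_scaleC_right scaleC_one)

lemma norm_umul: "norm (umul x b) \<le> 2 * norm x * norm b"
proof -
  have "norm (umul x b) \<le> norm (fst x) * norm b + norm (snd x) * norm b"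
    unfolding umul_def
    by (rule order_trans[OF norm_triangle_ineq add_mono[OF norm_mult_ineq]]) (simp add: norm_scaleC)
  then show ?thesis
    using mult_right_mono[OF norm_fst_snd_le(1)[of x], of "norm b"]
      mult_right_mono[OF norm_fst_snd_le(2)[of x], of "norm b"] by simp
qed

lemma norm_lmul: "norm (lmul a x) \<le> 2 * norm a * norm x"
proof -
  have "norm (lmul a x) \<le> norm a * norm (fst x) + norm (snd x) * norm a"
    unfolding lmul_def
    by (rule order_trans[OF norm_triangle_ineq add_mono[OF norm_mult_ineq]]) (simp add: norm_scaleC)
  then show ?thesis
    using mult_left_mono[OF norm_fst_snd_le(1)[of x], of "norm a"]
      mult_right_mono[OF norm_fst_snd_le(2)[of x], of "norm a"]
    by (simp add: mult.commute[of _ "norm a"])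
qed

text \<open>
  Let \<open>A#\<close> be the unitization of \<open>A\<close>. The kernel of the multiplication \<open>A# \<otimes> A# \<rightarrow> A#\<close> is the closed
  span of the elements \<open>xb \<otimes> 1 - x \<otimes> b\<close> with \<open>x \<in> A#\<close> and \<open>b \<in> A\<close>, so its bounded functionals correspond to bounded
  bilinear forms on \<open>A# \<times> A\<close>. The actions of \<open>A\<close> on these forms are dual to
  \<open>c (xb \<otimes> 1 - x \<otimes> b)\<close> and \<open>(xb \<otimes> 1 - x \<otimes> b) c\<close>.
\<close>

type_synonym 'a unital_forms = "('a \<times> complex, 'a) bilinear_form"

definition form_ract :: "'a::complex_banach_algebra unital_forms \<Rightarrow> 'a \<Rightarrow> 'a unital_forms" where
  "form_ract \<psi> a = form (\<lambda>x b. cblinfun_apply (cblinfun_apply \<psi> (lmul a x, 0)) b)"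

definition form_lact :: "'a::complex_banach_algebra \<Rightarrow> 'a unital_forms \<Rightarrow> 'a unital_forms" where
  "form_lact a \<psi> = form (\<lambda>x b. cblinfun_apply (cblinfun_apply \<psi> x) (b * a)
     - cblinfun_apply (cblinfun_apply \<psi> (umul x b, 0)) a)"

lemma bounded_form_ract:
  "bounded_form (2 * norm a * norm \<psi>) (\<lambda>x b. cblinfun_apply (cblinfun_apply \<psi> (lmul a x, 0)) b)"
proof -
  have "cmod (cblinfun_apply (cblinfun_apply \<psi> (lmul a x, 0)) b) \<le> 2 * norm a * norm \<psi> * norm x * norm b"
    for x b
  proof -
    have "cmod (cblinfun_apply (cblinfun_apply \<psi> (lmul a x, 0)) b) \<le> norm \<psi> * norm (lmul a x) * norm b"
      using form_apply_bound[of \<psi> "(lmul a x, 0)" b] by simp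
    also have "\<dots> \<le> norm \<psi> * (2 * norm a * norm x) * norm b"
      by (intro mult_right_mono mult_left_mono norm_lmul) auto
    finally show ?thesis by (simp add: mult_ac)
  qed
  then show ?thesis
    by (simp add: bounded_form_def lmul_linear cblinfun_apply_Pair_0 scaleC_complex_def)
qed

lemma bounded_form_lact:
  "bounded_form (3 * norm a * norm \<psi>) (\<lambda>x b. cblinfun_apply (cblinfun_apply \<psi> x) (b * a)
     - cblinfun_apply (cblinfun_apply \<psi> (umul x b, 0)) a)"
proof -
  have "cmod (cblinfun_apply (cblinfun_apply \<psi> x) (b * a) - cblinfun_apply (cblinfun_apply \<psi> (umul x b, 0)) a)
      \<le> 3 * norm a * norm \<psi> * norm x * norm b" for x b
  proof -
    have "cmod (cblinfun_apply (cblinfun_apply \<psi> x) (b * a)) \<le> norm \<psi> * norm x * (norm b * norm a)"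
      by (rule order_trans[OF form_apply_bound]) (intro mult_left_mono norm_mult_ineq mult_nonneg_nonneg norm_ge_zero)
    moreover have "cmod (cblinfun_apply (cblinfun_apply \<psi> (umul x b, 0)) a) \<le> norm \<psi> * (2 * norm x * norm b) * norm a"
      using form_apply_bound[of \<psi> "(umul x b, 0)" a]
        mult_right_mono[OF mult_left_mono[OF norm_umul[of x b], of "norm \<psi>"], of "norm a"] by simp
    ultimately show ?thesis
      by (intro order_trans[OF norm_triangle_ineq4]) (simp add: mult_ac)
  qed
  then show ?thesis
    by (simp add: bounded_form_def umul_linear cblinfun_apply_Pair_0 scaleC_complex_def
        mult_scaleC_left distrib_right distrib_left right_diff_distrib)
qed

lemma form_ract_apply:
  "cblinfun_apply (cblinfun_apply (form_ract \<psi> a) x) b = cblinfun_apply (cblinfun_apply \<psi> (lmul a x, 0)) b"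
  unfolding form_ract_def by (rule form_apply[OF bounded_form_ract])

lemma form_lact_apply:
  "cblinfun_apply (cblinfun_apply (form_lact a \<psi>) x) b = cblinfun_apply (cblinfun_apply \<psi> x) (b * a)
     - cblinfun_apply (cblinfun_apply \<psi> (umul x b, 0)) a"
  unfolding form_lact_def by (rule form_apply[OF bounded_form_lact])

interpretation unital_forms: bimodule_type
  "form_lact :: 'a::complex_banach_algebra \<Rightarrow> _" form_ract 3
proof
  fix a b :: 'a and \<psi> \<psi>' :: "'a unital_forms" and c
  show "norm (form_lact a \<psi>) \<le> 3 * norm a * norm \<psi>"
    unfolding form_lact_def by (rule norm_form[OF bounded_form_lact])
  have "norm (form_ract \<psi> a) \<le> 2 * norm a * norm \<psi>"
    unfolding form_ract_def by (rule norm_form[OF bounded_form_ract])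
  also have "\<dots> \<le> 3 * norm a * norm \<psi>" by (intro mult_right_mono) auto
  finally show "norm (form_ract \<psi> a) \<le> 3 * norm a * norm \<psi>" .
qed (rule form_eqI; simp add: form_lact_apply form_ract_apply lmul_linear umul_linear lmul_mult umul_mult
      lmul_times umul_0 lmul_0 cblinfun_apply_Pair_0 scaleC_complex_def mult_scaleC_right mult_scaleC_left
      distrib_left distrib_right right_diff_distrib mult.assoc)+

text \<open>
  Evaluation at \<open>(1, a)\<close> is the universal derivation \<open>a \<mapsto> a \<otimes> 1 - 1 \<otimes> a\<close>; that it is inner is
  the whole content of amenability. The functional \<open>M\<close> plays the role of \<open>1 \<otimes> 1\<close> minus a virtual
  diagonal. A form is determined by its values at the points \<open>(x, 1)\<close>, which is how it becomes a
  point of the test type.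
\<close>

lemma amenable_universal_functional:
  assumes "amenable_on TYPE('a::complex_banach_algebra test_points) TYPE('a)"
  obtains M :: "'a::complex_banach_algebra unital_forms dual" where
    "\<And>a \<psi>. cblinfun_apply (cblinfun_apply \<psi> (0, 1)) a
      = cblinfun_apply M (form_ract \<psi> a) - cblinfun_apply M (form_lact a \<psi>)"
proof -
  define g :: "'a unital_forms \<Rightarrow> 'a test_points"
    where "g \<psi> = {\<lambda>x. cblinfun_apply (cblinfun_apply \<psi> (x, 1))}" for \<psi>
  have "inj g"
  proof (rule injI)
    fix \<psi> \<psi>' assume "g \<psi> = g \<psi>'"
    then have eq: "cblinfun_apply \<psi> (x, 1) = cblinfun_apply \<psi>' (x, 1)" for x
      by (intro cblinfun_eqI) (auto simp: g_def dest: fun_cong)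
    have decomp: "x = (fst x, 1) + (snd x - 1) *\<^sub>C (0, 1)" for x :: "'a \<times> complex"
      by (simp add: prod_eq_iff scaleC_complex_def)
    show "\<psi> = \<psi>'"
    proof (rule cblinfun_eqI)
      fix x show "cblinfun_apply \<psi> x = cblinfun_apply \<psi>' x"
        by (subst (1 2) decomp) (simp only: cblinfun_apply_simps eq)
    qed
  qed
  have "\<exists>f :: 'a unital_forms dual. cblinfun_apply f = (\<lambda>\<psi>. cblinfun_apply (cblinfun_apply \<psi> (0, 1)) a)" for a
    by (rule cblinfun_exists[of "\<lambda>\<psi> :: 'a unital_forms. cblinfun_apply (cblinfun_apply \<psi> (0, 1)) a" "norm a"])
      (use form_apply_bound[of _ "(0 :: 'a, 1 :: complex)" a] in \<open>auto simp: mult.commute\<close>)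
  then obtain \<delta> :: "'a \<Rightarrow> 'a unital_forms dual"
    where \<delta>: "\<And>a \<psi>. cblinfun_apply (\<delta> a) \<psi> = cblinfun_apply (cblinfun_apply \<psi> (0, 1)) a" by metis
  show thesis
  proof (rule unital_forms.derivation_inner[OF assms \<open>inj g\<close>, of \<delta> 1])
    show "norm (\<delta> a) \<le> 1 * norm a" for a
      by (rule norm_cblinfun_bound) (use form_apply_bound[of _ "(0 :: 'a, 1 :: complex)" a] in \<open>auto simp: \<delta> mult.commute\<close>)
  qed (auto simp: \<delta> form_lact_apply form_ract_apply lmul_1 umul_1 lmul_0 umul_0 intro!: cblinfun_eqI that)
qed

section \<open>Algebras on which an amenable algebra acts by multipliers\<close>

text \<open>
  The model case is a left ideal of \<open>A\<close> whose opposite algebra is \<open>B\<close>: the action of \<open>A\<close> on \<open>B\<close>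
  commutes with the left multiplications of \<open>B\<close>, and each right multiplication of \<open>B\<close> is the action
  of some element of \<open>A\<close>.
\<close>

locale multiplier_action =
  fixes act :: "'a::complex_banach_algebra \<Rightarrow> 'b::complex_banach_algebra \<Rightarrow> 'b" and C :: real
  assumes act_add_left: "act (S + S') R = act S R + act S' R"
    and act_scaleC_left: "act (c *\<^sub>C S) R = c *\<^sub>C act S R"
    and act_add_right: "act S (R + R') = act S R + act S R'"
    and act_scaleC_right: "act S (c *\<^sub>C R) = c *\<^sub>C act S R"
    and act_bound: "norm (act S R) \<le> C * norm S * norm R"
    and act_mult: "act (S * S') R = act S (act S' R)"
    and act_right: "act S (T * R) = T * act S R"
    and right_multiplication: "\<exists>S. \<forall>R. act S R = R * T"
begin

definition J :: "'b \<Rightarrow> 'a" where "J T = (SOME S. \<forall>R. act S R = R * T)"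

lemma act_J: "act (J T) R = R * T"
  using someI_ex[OF right_multiplication[of T]] by (simp add: J_def)

definition uact :: "'a \<times> complex \<Rightarrow> 'b \<Rightarrow> 'b" where
  "uact x R = act (fst x) R + snd x *\<^sub>C R"

lemma uact_linear:
  "uact (x + y) R = uact x R + uact y R" "uact (c *\<^sub>C x) R = c *\<^sub>C uact x R"
  "uact x (R + R') = uact x R + uact x R'" "uact x (c *\<^sub>C R) = c *\<^sub>C uact x R"
  by (simp_all add: uact_def act_add_left act_scaleC_left act_add_right act_scaleC_right
      scaleC_add_left scaleC_add_right scaleC_scaleC scaleC_complex_def mult.commute)

lemma uact_mult: "uact x (T * R) = T * uact x R"
  and uact_umul: "uact (umul x b, 0) R = uact x (act b R)"
  and uact_lmul: "uact (lmul b x, 0) R = act b (uact x R)"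
  and uact_0: "uact (b, 0) R = act b R" and uact_1: "uact (0, 1) R = R"
proof -
  have "act 0 R = 0" using act_scaleC_left[of 0 0 R] by simp
  then show "uact (0, 1) R = R" by (simp add: uact_def scaleC_one)
qed (simp_all add: uact_def act_right distrib_left mult_scaleC_right umul_def lmul_def act_mult
      act_add_left act_scaleC_left act_add_right act_scaleC_right)

lemma norm_uact: "norm (uact x R) \<le> (\<bar>C\<bar> + 1) * norm x * norm R"
proof -
  have "norm (uact x R) \<le> \<bar>C\<bar> * norm (fst x) * norm R + norm (snd x) * norm R"
    unfolding uact_def
  proof (rule order_trans[OF norm_triangle_ineq add_mono])
    show "norm (act (fst x) R) \<le> \<bar>C\<bar> * norm (fst x) * norm R"
      by (rule order_trans[OF act_bound]) (intro mult_right_mono, auto)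
  qed (simp add: norm_scaleC)
  also have "\<dots> \<le> \<bar>C\<bar> * norm x * norm R + norm x * norm R"
    by (intro add_mono mult_right_mono mult_left_mono norm_fst_snd_le) auto
  finally show ?thesis by (simp add: algebra_simps)
qed

end

definition bounded_functional :: "('a, 'w) bimodule \<Rightarrow> ('w \<Rightarrow> complex) \<Rightarrow> bool" where
  "bounded_functional Z f \<longleftrightarrow>
     (\<forall>x\<in>points Z. \<forall>y\<in>points Z. f (vadd Z x y) = f x + f y) \<and>
     (\<forall>c. \<forall>x\<in>points Z. f (vscale Z c x) = c * f x) \<and>
     (\<exists>K. \<forall>x\<in>points Z. cmod (f x) \<le> K * vnorm Z x)"

lemma bounded_functionalI:
  assumes "\<And>x y. x \<in> points Z \<Longrightarrow> y \<in> points Z \<Longrightarrow> f (vadd Z x y) = f x + f y"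
    and "\<And>c x. x \<in> points Z \<Longrightarrow> f (vscale Z c x) = c * f x"
    and "\<And>x. x \<in> points Z \<Longrightarrow> cmod (f x) \<le> K * vnorm Z x"
  shows "bounded_functional Z f"
  using assms unfolding bounded_functional_def by blast

lemma bounded_functional_vadd: "bounded_functional Z f \<Longrightarrow> x \<in> points Z \<Longrightarrow> y \<in> points Z
    \<Longrightarrow> f (vadd Z x y) = f x + f y"
  and bounded_functional_vscale: "bounded_functional Z f \<Longrightarrow> x \<in> points Z
    \<Longrightarrow> f (vscale Z c x) = c * f x"
  by (simp_all add: bounded_functional_def)

text \<open>
  A continuous derivation \<open>D\<close> into the dual of \<open>Z\<close> enters as the bilinear map \<open>d T y = D(T)(y)\<close>.
  The remaining data are a bounded approximate identity \<open>e\<close>, a generalized limit along its filter, and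
  the functional \<open>M\<close> that amenability of the acting algebra provides.
\<close>

locale derivation_data = banach_bimodule Z + multiplier_action act C + generalized_limit F Lm
  for Z :: "('b::complex_banach_algebra, 'w) bimodule"
    and act :: "'a::complex_banach_algebra \<Rightarrow> 'b \<Rightarrow> 'b" and C :: real
    and F :: "'i filter" and Lm :: "('i \<Rightarrow> complex) \<Rightarrow> complex" +
  fixes d :: "'b \<Rightarrow> 'w \<Rightarrow> complex" and K B E :: real and e :: "'i \<Rightarrow> 'b"
    and M :: "'a unital_forms dual"
  assumes d_add: "y \<in> points Z \<Longrightarrow> d (S + T) y = d S y + d T y"
    and d_scaleC: "y \<in> points Z \<Longrightarrow> d (c *\<^sub>C T) y = c * d T y"
    and d_vadd: "x \<in> points Z \<Longrightarrow> y \<in> points Z \<Longrightarrow> d T (vadd Z x y) = d T x + d T y"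
    and d_vscale: "y \<in> points Z \<Longrightarrow> d T (vscale Z c y) = c * d T y"
    and d_bound: "y \<in> points Z \<Longrightarrow> cmod (d T y) \<le> K * norm T * vnorm Z y"
    and d_mult: "y \<in> points Z \<Longrightarrow> d (S * T) y = d T (ract Z y S) + d S (lact Z T y)"
    and K_nonneg: "0 \<le> K" and B_nonneg: "0 \<le> B"
    and lact_bound: "y \<in> points Z \<Longrightarrow> vnorm Z (lact Z T y) \<le> B * norm T * vnorm Z y"
    and e_bound: "norm (e i) \<le> E"
    and e_left: "((\<lambda>i. e i * T) \<longlongrightarrow> T) F" and e_right: "((\<lambda>i. T * e i) \<longlongrightarrow> T) F"
    and M: "cblinfun_apply (cblinfun_apply \<psi> (0, 1)) a
      = cblinfun_apply M (form_ract \<psi> a) - cblinfun_apply M (form_lact a \<psi>)"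
begin

abbreviation "Y \<equiv> points Z"

lemma E_nonneg: "0 \<le> E"
  using e_bound norm_ge_zero order_trans by blast

lemmas closed = vadd_closed vscale_closed lact_closed ract_closed

lemma d_functional: "bounded_functional Z (d T)"
  by (rule bounded_functionalI[OF _ _ d_bound]) (auto simp: d_vadd d_vscale)

lemma bounded_linear_d: "y \<in> Y \<Longrightarrow> bounded_linear (\<lambda>T. d T y)"
  by (rule bounded_linear_intro[of _ "K * vnorm Z y"])
    (use d_bound[of y] in \<open>auto simp: d_add scaleR_scaleC[of _ "_ :: 'b"] d_scaleC scaleR_conv_of_real mult_ac\<close>)

text \<open>
  The expressions below are bounded linear in an element \<open>R\<close> of \<open>B\<close>. This makes the corresponding families
  along the approximate identity bounded and turns norm convergence of \<open>e i * T\<close> and \<open>T * e i\<close> to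
  \<open>T\<close> into convergence of their values.
\<close>

lemma bounded_linear_lact:
  assumes f: "bounded_functional Z f" and y: "y \<in> Y"
  shows "bounded_linear (\<lambda>R. f (lact Z R y))"
proof -
  obtain N where N: "\<And>x. x \<in> Y \<Longrightarrow> cmod (f x) \<le> N * vnorm Z x"
    using f unfolding bounded_functional_def by blast
  show ?thesis
  proof (rule bounded_linear_intro[of _ "\<bar>N\<bar> * B * vnorm Z y"])
    fix R R' r
    show "f (lact Z (R + R') y) = f (lact Z R y) + f (lact Z R' y)"
      using y by (simp add: lact_add bounded_functional_vadd[OF f] closed)
    show "f (lact Z (r *\<^sub>R R) y) = r *\<^sub>R f (lact Z R y)"
      using y by (simp add: scaleR_scaleC[of _ R] lact_scaleC bounded_functional_vscale[OF f] closed
          scaleR_conv_of_real)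
    have "cmod (f (lact Z R y)) \<le> N * vnorm Z (lact Z R y)" using y by (simp add: N closed)
    also have "\<dots> \<le> \<bar>N\<bar> * vnorm Z (lact Z R y)"
      by (intro mult_right_mono) (use y in \<open>auto simp: closed vnorm_nonneg\<close>)
    also have "\<dots> \<le> \<bar>N\<bar> * (B * norm R * vnorm Z y)"
      by (intro mult_left_mono lact_bound y) simp
    finally show "norm (f (lact Z R y)) \<le> norm R * (\<bar>N\<bar> * B * vnorm Z y)" by (simp add: mult_ac)
  qed
qed

lemma bounded_range_e: "bounded_linear (f :: 'b \<Rightarrow> complex) \<Longrightarrow> bounded (range (\<lambda>i. f (e i)))"
  using bounded_linear_image[of "range e" f] boundedI[of "range e" E] e_bound by (auto simp: image_image)

lemma bounded_linear_mult_left_right: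
  "bounded_linear (f :: 'b \<Rightarrow> complex) \<Longrightarrow> bounded_linear (\<lambda>R. f (R * T))"
  "bounded_linear f \<Longrightarrow> bounded_linear (\<lambda>R. f (T * R))"
  using bounded_linear_compose[OF _ bounded_linear_mult_left[of T]]
    bounded_linear_compose[OF _ bounded_linear_mult_right[of T]] by auto

lemma Lm_e_left: "bounded_linear f \<Longrightarrow> Lm (\<lambda>i. f (e i * T)) = f T"
  and Lm_e_right: "bounded_linear f \<Longrightarrow> Lm (\<lambda>i. f (T * e i)) = f T"
  using Lm_tendsto[OF bounded_range_e[OF bounded_linear_mult_left_right(1)[of f T]]
      bounded_linear.tendsto[OF _ e_left]]
    Lm_tendsto[OF bounded_range_e[OF bounded_linear_mult_left_right(2)[of f T]]
      bounded_linear.tendsto[OF _ e_right]] by auto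

lemma bounded_linear_uact: "bounded_linear (uact x)"
  by (rule bounded_linear_intro[of _ "(\<bar>C\<bar> + 1) * norm x"])
    (use norm_uact[of x] in \<open>auto simp: uact_linear scaleR_scaleC mult_ac\<close>)

text \<open>
  The weak* limit of the functionals \<open>D(T) \<cdot> (x e i)\<close>, where \<open>x e i\<close> denotes the action of \<open>x\<close> on
  \<open>e i\<close>. It extends the right action of \<open>B\<close> on \<open>D(T)\<close> to the unitization of \<open>A\<close>; on a bimodule that is not
  essential, \<open>x = 1\<close> need not act as the identity.
\<close>

definition \<tau> :: "'a \<times> complex \<Rightarrow> 'b \<Rightarrow> 'w \<Rightarrow> complex" where
  "\<tau> x T y = Lm (\<lambda>i. d T (lact Z (uact x (e i)) y))"

definition "N = K * B * (\<bar>C\<bar> + 1) * E"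

lemma N_nonneg: "0 \<le> N"
  using K_nonneg B_nonneg E_nonneg by (simp add: N_def)

lemma bounded_linear_d_uact: "y \<in> Y \<Longrightarrow> bounded_linear (\<lambda>R. d T (lact Z (uact x R) y))"
  by (rule bounded_linear_compose[OF bounded_linear_lact[OF d_functional] bounded_linear_uact])

lemmas bounded_d_uact = bounded_range_e[OF bounded_linear_d_uact]

lemma \<tau>_linear:
  assumes "y \<in> Y"
  shows "\<tau> (x + x') T y = \<tau> x T y + \<tau> x' T y" "\<tau> (c *\<^sub>C x) T y = c * \<tau> x T y"
    "\<tau> x (T + T') y = \<tau> x T y + \<tau> x T' y" "\<tau> x (c *\<^sub>C T) y = c * \<tau> x T y"
  using assms unfolding \<tau>_def
  by (simp_all add: Lm_add[symmetric] Lm_mult[symmetric] bounded_d_uact uact_linear lact_add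
      lact_scaleC d_add d_scaleC d_vadd d_vscale closed)

lemma \<tau>_functional_linear:
  assumes "y \<in> Y"
  shows "y' \<in> Y \<Longrightarrow> \<tau> x T (vadd Z y y') = \<tau> x T y + \<tau> x T y'" "\<tau> x T (vscale Z c y) = c * \<tau> x T y"
  using assms unfolding \<tau>_def
  by (simp_all add: Lm_add[symmetric] Lm_mult[symmetric] bounded_d_uact lact_vadd
      lact_vscale d_vadd d_vscale closed)

lemma \<tau>_bound:
  assumes y: "y \<in> Y"
  shows "cmod (\<tau> x T y) \<le> N * norm x * norm T * vnorm Z y"
  unfolding \<tau>_def
proof (rule Lm_bound)
  fix i
  have "norm (uact x (e i)) \<le> (\<bar>C\<bar> + 1) * norm x * E"
    by (rule order_trans[OF norm_uact]) (intro mult_left_mono e_bound, simp)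
  then have "B * norm (uact x (e i)) * vnorm Z y \<le> B * ((\<bar>C\<bar> + 1) * norm x * E) * vnorm Z y"
    by (intro mult_right_mono mult_left_mono) (use B_nonneg y in \<open>auto simp: vnorm_nonneg\<close>)
  then have "vnorm Z (lact Z (uact x (e i)) y) \<le> B * ((\<bar>C\<bar> + 1) * norm x * E) * vnorm Z y"
    using lact_bound[OF y] order_trans by blast
  then have "K * norm T * vnorm Z (lact Z (uact x (e i)) y)
      \<le> K * norm T * (B * ((\<bar>C\<bar> + 1) * norm x * E) * vnorm Z y)"
    by (intro mult_left_mono) (use K_nonneg in auto)
  then show "cmod (d T (lact Z (uact x (e i)) y)) \<le> N * norm x * norm T * vnorm Z y"
    by (intro order_trans[OF d_bound[OF lact_closed[OF y]]]) (simp add: N_def mult_ac)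
qed

lemma bounded_linear_\<tau>: "y \<in> Y \<Longrightarrow> bounded_linear (\<lambda>T. \<tau> x T y)"
  by (rule bounded_linear_intro[of _ "N * norm x * vnorm Z y"])
    (use \<tau>_bound[of y x] in \<open>auto simp: \<tau>_linear scaleR_scaleC[of _ "_ :: 'b"] scaleR_conv_of_real mult_ac\<close>)

lemma \<tau>_lact: "y \<in> Y \<Longrightarrow> \<tau> x S (lact Z T y) = \<tau> (lmul (J T) x, 0) S y"
  by (simp add: \<tau>_def uact_lmul act_J lact_mult)

lemma \<tau>_J: "y \<in> Y \<Longrightarrow> \<tau> (J T, 0) S y = d S (lact Z T y)"
  using Lm_e_left[OF bounded_linear_lact[OF d_functional], of y S T]
  by (simp add: \<tau>_def uact_0 act_J)

text \<open>
  The derivation identity, multiplied by \<open>x e i\<close>. In the term with \<open>D(T)\<close> the product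
  \<open>Q (x e i) = x (Q e i)\<close> converges in norm, so no limit remains there.
\<close>

lemma \<tau>_ract:
  assumes y: "y \<in> Y"
  shows "\<tau> x Q (ract Z y T) = \<tau> x (T * Q) y - d T (lact Z (uact x Q) y)"
proof -
  have eq: "d Q (lact Z W (ract Z y T)) = d (T * Q) (lact Z W y) - d T (lact Z (Q * W) y)" for W
    using y by (simp add: d_mult closed lact_ract lact_mult)
  have bl: "bounded_linear (\<lambda>R. d T (lact Z (uact x R) y))"
    using y by (rule bounded_linear_d_uact)
  show ?thesis
    unfolding \<tau>_def eq
    using Lm_diff[OF bounded_d_uact[OF y, of "T * Q" x]
        bounded_range_e[OF bounded_linear_mult_left_right(2)[OF bl, of Q]]]
      Lm_e_right[OF bl, of Q] by (simp add: uact_mult)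
qed

text \<open>
  With a diagonal \<open>\<Sum> x \<otimes> b\<close> of \<open>A\<close>, a derivation on \<open>A\<close> is implemented by \<open>\<Sum> x D(b)\<close>. Here \<open>b\<close> is moved into \<open>B\<close>
  by letting it act on \<open>R\<close>, which later runs through the approximate identity, and \<open>\<tau>\<close> moves
  \<open>x\<close>. Subtracting the value at \<open>xb \<otimes> 1\<close> restricts this form on \<open>A# \<otimes> A#\<close> to the
  kernel of the multiplication, on which \<open>M\<close> lives. It also makes the terms with \<open>D(T)\<close> cancel in
  \<open>\<Xi>_ract\<close>, and those from the twist of the left action in \<open>form_lact_\<Xi>\<close>. Without the
  subtraction these would offset each other only in the limit, and only pointwise in \<open>b\<close>.
\<close>

definition \<Xi> :: "'w \<Rightarrow> 'b \<Rightarrow> 'a unital_forms" where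
  "\<Xi> y R = form (\<lambda>x b. \<tau> x (act b R) y - \<tau> (umul x b, 0) R y)"

lemma bounded_form_\<Xi>:
  assumes y: "y \<in> Y"
  shows "bounded_form (N * (\<bar>C\<bar> + 2) * norm R * vnorm Z y) (\<lambda>x b. \<tau> x (act b R) y - \<tau> (umul x b, 0) R y)"
proof -
  have "cmod (\<tau> x (act b R) y - \<tau> (umul x b, 0) R y)
      \<le> N * (\<bar>C\<bar> + 2) * norm R * vnorm Z y * norm x * norm b" for x b
  proof -
    have "cmod (\<tau> x (act b R) y) \<le> N * norm x * (\<bar>C\<bar> * norm b * norm R) * vnorm Z y"
    proof (rule order_trans[OF \<tau>_bound[OF y]])
      have "norm (act b R) \<le> \<bar>C\<bar> * norm b * norm R"
        by (rule order_trans[OF act_bound]) (intro mult_right_mono, auto)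
      then show "N * norm x * norm (act b R) * vnorm Z y \<le> N * norm x * (\<bar>C\<bar> * norm b * norm R) * vnorm Z y"
        by (intro mult_right_mono mult_left_mono) (use N_nonneg y in \<open>auto simp: vnorm_nonneg\<close>)
    qed
    moreover have "cmod (\<tau> (umul x b, 0) R y) \<le> N * (2 * norm x * norm b) * norm R * vnorm Z y"
    proof (rule order_trans[OF \<tau>_bound[OF y]])
      show "N * norm (umul x b, 0 :: complex) * norm R * vnorm Z y
          \<le> N * (2 * norm x * norm b) * norm R * vnorm Z y"
        by (intro mult_right_mono mult_left_mono) (use N_nonneg y norm_umul[of x b] in \<open>auto simp: vnorm_nonneg\<close>)
    qed
    ultimately have "cmod (\<tau> x (act b R) y - \<tau> (umul x b, 0) R y)
        \<le> N * norm x * (\<bar>C\<bar> * norm b * norm R) * vnorm Z y + N * (2 * norm x * norm b) * norm R * vnorm Z y"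
      by (intro order_trans[OF norm_triangle_ineq4] add_mono)
    also have "\<dots> = N * (\<bar>C\<bar> + 2) * norm R * vnorm Z y * norm x * norm b" by (simp add: algebra_simps)
    finally show ?thesis .
  qed
  moreover have "(a + b, 0) = (a, 0) + (b, 0 :: complex)" "(c *\<^sub>C a, 0) = c *\<^sub>C (a, 0 :: complex)" for a b :: 'a and c
    by (simp_all add: scaleC_prod_def)
  ultimately show ?thesis
    using N_nonneg y vnorm_nonneg[OF y] unfolding bounded_form_def
    by (simp only: \<tau>_linear[OF y] umul_linear act_add_left act_scaleC_left) (simp add: algebra_simps)
qed

lemma \<Xi>_apply:
  "y \<in> Y \<Longrightarrow> cblinfun_apply (cblinfun_apply (\<Xi> y R) x) b = \<tau> x (act b R) y - \<tau> (umul x b, 0) R y"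
  unfolding \<Xi>_def by (rule form_apply[OF bounded_form_\<Xi>])

lemma norm_\<Xi>: "y \<in> Y \<Longrightarrow> norm (\<Xi> y R) \<le> N * (\<bar>C\<bar> + 2) * norm R * vnorm Z y"
  unfolding \<Xi>_def by (rule norm_form[OF bounded_form_\<Xi>])

lemma \<Xi>_linear:
  assumes "y \<in> Y"
  shows "\<Xi> y (R + R') = \<Xi> y R + \<Xi> y R'" "\<Xi> y (c *\<^sub>C R) = c *\<^sub>C \<Xi> y R"
    "y' \<in> Y \<Longrightarrow> \<Xi> (vadd Z y y') R = \<Xi> y R + \<Xi> y' R" "\<Xi> (vscale Z c y) R = c *\<^sub>C \<Xi> y R"
  using assms
  by (intro form_eqI; simp add: \<Xi>_apply closed \<tau>_linear \<tau>_functional_linear act_add_right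
      act_scaleC_right scaleC_complex_def algebra_simps)+

lemma \<Xi>_lact: "y \<in> Y \<Longrightarrow> \<Xi> (lact Z T y) R = form_ract (\<Xi> y R) (J T)"
  by (rule form_eqI) (simp add: \<Xi>_apply closed form_ract_apply \<tau>_lact umul_0 lmul_0 lmul_times)

lemma \<Xi>_ract: "y \<in> Y \<Longrightarrow> \<Xi> (ract Z y T) R = \<Xi> y (T * R)"
  by (rule form_eqI) (simp add: \<Xi>_apply closed \<tau>_ract act_right uact_umul)

lemma form_lact_\<Xi>: "y \<in> Y \<Longrightarrow> form_lact (J T) (\<Xi> y R) = \<Xi> y (R * T)"
  by (rule form_eqI) (simp add: \<Xi>_apply form_lact_apply act_mult act_J umul_mult umul_0)

definition "m y R = cblinfun_apply M (\<Xi> y R)"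

lemma bounded_linear_m: "y \<in> Y \<Longrightarrow> bounded_linear (m y)"
proof (rule bounded_linear_intro[of _ "norm M * (N * (\<bar>C\<bar> + 2)) * vnorm Z y"])
  fix R assume y: "y \<in> Y"
  have "norm M * norm (\<Xi> y R) \<le> norm M * (N * (\<bar>C\<bar> + 2) * norm R * vnorm Z y)"
    by (intro mult_left_mono norm_\<Xi> y) simp
  then show "norm (m y R) \<le> norm R * (norm M * (N * (\<bar>C\<bar> + 2)) * vnorm Z y)"
    unfolding m_def by (intro order_trans[OF norm_cblinfun_apply]) (simp add: mult_ac)
qed (simp_all add: m_def \<Xi>_linear scaleR_scaleC[of _ "_ :: 'b"] scaleR_conv_of_real scaleC_complex_def)

text \<open>
  The defining property of \<open>M\<close> at the form \<open>\<Xi> y R\<close>. By \<open>\<Xi>_ract\<close> the second term differs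
  from \<open>m (y T) R\<close> only by \<open>m y (R T - T R)\<close>, which vanishes as \<open>R\<close> runs through the approximate
  identity.
\<close>

lemma m_lact:
  assumes y: "y \<in> Y"
  shows "m (lact Z T y) R - m y (R * T) = \<tau> (0, 1) (R * T) y - d R (lact Z T y)"
  using M[of "\<Xi> y R" "J T"] y
  by (simp add: m_def \<Xi>_lact form_lact_\<Xi> \<Xi>_apply act_J umul_1 \<tau>_J)

definition "h y = Lm (\<lambda>i. m y (e i))"
definition "k y = Lm (\<lambda>i. d (e i) y)"
definition "q y = Lm (\<lambda>i. k (lact Z (e i) y))"

lemmas bounded_m = bounded_range_e[OF bounded_linear_m]
lemmas bounded_d = bounded_range_e[OF bounded_linear_d]

lemma k_functional: "bounded_functional Z k"
proof (rule bounded_functionalI)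
  fix y assume y: "y \<in> Y"
  show "cmod (k y) \<le> (K * E) * vnorm Z y"
    unfolding k_def
  proof (rule Lm_bound)
    fix i
    have "K * norm (e i) * vnorm Z y \<le> K * E * vnorm Z y"
      by (intro mult_right_mono mult_left_mono e_bound) (use K_nonneg y in \<open>auto simp: vnorm_nonneg\<close>)
    with d_bound[OF y] show "cmod (d (e i) y) \<le> (K * E) * vnorm Z y" by (rule order_trans)
  qed
qed (simp_all add: k_def d_vadd d_vscale Lm_add Lm_mult bounded_d)

lemmas bounded_k = bounded_range_e[OF bounded_linear_lact[OF k_functional]]

lemma q_functional: "bounded_functional Z q"
proof -
  obtain N' where N': "\<And>x. x \<in> Y \<Longrightarrow> cmod (k x) \<le> N' * vnorm Z x"
    using k_functional unfolding bounded_functional_def by blast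
  show ?thesis
  proof (rule bounded_functionalI)
    fix y assume y: "y \<in> Y"
    show "cmod (q y) \<le> (\<bar>N'\<bar> * (B * E)) * vnorm Z y"
      unfolding q_def
    proof (rule Lm_bound)
      fix i
      have "cmod (k (lact Z (e i) y)) \<le> \<bar>N'\<bar> * vnorm Z (lact Z (e i) y)"
        by (rule order_trans[OF N' mult_right_mono]) (use y in \<open>auto simp: closed vnorm_nonneg\<close>)
      also have "\<dots> \<le> \<bar>N'\<bar> * (B * E * vnorm Z y)"
        by (intro mult_left_mono order_trans[OF lact_bound[OF y]] mult_right_mono e_bound)
          (use B_nonneg y in \<open>auto simp: vnorm_nonneg\<close>)
      finally show "cmod (k (lact Z (e i) y)) \<le> (\<bar>N'\<bar> * (B * E)) * vnorm Z y" by (simp add: mult_ac)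
    qed
  qed (simp_all add: q_def lact_vadd lact_vscale bounded_functional_vadd[OF k_functional]
      bounded_functional_vscale[OF k_functional] closed Lm_add Lm_mult bounded_k)
qed

lemma h_functional: "bounded_functional Z h"
proof (rule bounded_functionalI)
  fix y assume y: "y \<in> Y"
  show "cmod (h y) \<le> (norm M * (N * (\<bar>C\<bar> + 2) * E)) * vnorm Z y"
    unfolding h_def
  proof (rule Lm_bound)
    fix i
    have "norm (\<Xi> y (e i)) \<le> N * (\<bar>C\<bar> + 2) * E * vnorm Z y"
      by (rule order_trans[OF norm_\<Xi>[OF y]])
        (intro mult_right_mono mult_left_mono e_bound, use N_nonneg y in \<open>auto simp: vnorm_nonneg\<close>)
    then have "norm M * norm (\<Xi> y (e i)) \<le> norm M * (N * (\<bar>C\<bar> + 2) * E * vnorm Z y)"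
      by (intro mult_left_mono) simp_all
    then show "cmod (m y (e i)) \<le> (norm M * (N * (\<bar>C\<bar> + 2) * E)) * vnorm Z y"
      unfolding m_def by (intro order_trans[OF norm_cblinfun_apply]) (simp add: mult_ac)
  qed
qed (simp_all add: h_def Lm_add[symmetric] Lm_mult[symmetric] bounded_m closed,
    simp_all add: m_def \<Xi>_linear scaleC_complex_def)

lemma h_lact_ract:
  assumes y: "y \<in> Y"
  shows "h (lact Z T y) - h (ract Z y T) = \<tau> (0, 1) T y - k (lact Z T y)"
proof -
  note bl = bounded_linear_mult_left_right[OF bounded_linear_m[OF y], of T]
  note b\<tau> = bounded_linear_mult_left_right(1)[OF bounded_linear_\<tau>[OF y, of "(0, 1)"], of T]
  have "h (lact Z T y) = Lm (\<lambda>i. m y (e i * T) + (\<tau> (0, 1) (e i * T) y - d (e i) (lact Z T y)))"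
    unfolding h_def by (rule arg_cong[of _ _ Lm]) (use m_lact[OF y] in \<open>auto simp: algebra_simps\<close>)
  also have "\<dots> = m y T + (\<tau> (0, 1) T y - k (lact Z T y))"
    using Lm_add[OF bounded_range_e[OF bl(1)] bounded_range_e[OF bounded_linear_sub[OF b\<tau> bounded_linear_d[OF lact_closed[OF y]]]]]
      Lm_diff[OF bounded_range_e[OF b\<tau>] bounded_d[OF lact_closed[OF y]]]
      Lm_e_left[OF bounded_linear_m[OF y]] Lm_e_left[OF bounded_linear_\<tau>[OF y]]
    by (simp add: k_def)
  moreover have "h (ract Z y T) = m y T"
    using Lm_e_right[OF bounded_linear_m[OF y]] y by (simp add: h_def m_def \<Xi>_ract)
  ultimately show ?thesis by simp
qed

lemma k_ract:
  assumes y: "y \<in> Y"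
  shows "k (ract Z y T) = d T y - \<tau> (0, 1) T y"
proof -
  have "k (ract Z y T) = Lm (\<lambda>i. d (T * e i) y - d T (lact Z (e i) y))"
    unfolding k_def using y by (simp add: d_mult)
  also have "\<dots> = d T y - \<tau> (0, 1) T y"
    using Lm_diff[OF bounded_range_e[OF bounded_linear_mult_left_right(2)[OF bounded_linear_d[OF y]]]
        bounded_range_e[OF bounded_linear_lact[OF d_functional y]]]
      Lm_e_right[OF bounded_linear_d[OF y]]
    by (simp add: \<tau>_def uact_1)
  finally show ?thesis .
qed

lemma q_lact: "y \<in> Y \<Longrightarrow> q (lact Z T y) = k (lact Z T y)"
  using Lm_e_left[OF bounded_linear_lact[OF k_functional]] by (simp add: q_def lact_mult[symmetric])

lemma q_ract:
  assumes y: "y \<in> Y"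
  shows "q (ract Z y T) = 0"
proof -
  have "k (lact Z (e i) (ract Z y T)) = 0" for i
    using y by (simp add: lact_ract k_ract closed \<tau>_lact lmul_1 \<tau>_J)
  then have "q (ract Z y T) = Lm (\<lambda>i. 0)" by (simp add: q_def)
  also have "\<dots> = 0" using Lm_bound[of "\<lambda>i. 0" 0] by simp
  finally show ?thesis .
qed

text \<open>
  The lemmas above give \<open>d T y = h (T y) - h (y T) + k (T y) + k (y T)\<close>, where the sum of the two \<open>k\<close>-terms has to
  become a difference. Split \<open>k\<close> into \<open>q\<close> and \<open>k - q\<close>: the first vanishes at \<open>y T\<close>, the second at
  \<open>T y\<close>. Hence the two terms are the commutator of \<open>q - (k - q)\<close>, and the functional
  \<open>- (h + 2 q - k)\<close> implements \<open>d\<close>.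
\<close>

lemma d_inner:
  obtains f where "bounded_functional Z f" "\<And>T y. y \<in> Y \<Longrightarrow> d T y = f (ract Z y T) - f (lact Z T y)"
proof
  show "d T y = (k (ract Z y T) - h (ract Z y T) - 2 * q (ract Z y T))
      - (k (lact Z T y) - h (lact Z T y) - 2 * q (lact Z T y))" if "y \<in> Y" for T y
    using h_lact_ract[OF that, of T] by (simp add: k_ract q_lact q_ract that algebra_simps)
  obtain a b c where bounds: "\<forall>x\<in>Y. cmod (k x) \<le> a * vnorm Z x" "\<forall>x\<in>Y. cmod (h x) \<le> b * vnorm Z x"
    "\<forall>x\<in>Y. cmod (q x) \<le> c * vnorm Z x"
    using k_functional h_functional q_functional unfolding bounded_functional_def by metis
  show "bounded_functional Z (\<lambda>y. k y - h y - 2 * q y)"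
  proof (rule bounded_functionalI)
    fix x assume x: "x \<in> Y"
    have "cmod (k x - h x - 2 * q x) \<le> cmod (k x) + cmod (h x) + 2 * cmod (q x)"
      using norm_triangle_ineq4[of "k x - h x" "2 * q x"] norm_triangle_ineq4[of "k x" "h x"]
      by (simp add: norm_mult)
    also have "\<dots> \<le> (a + b + 2 * c) * vnorm Z x" using bounds(1)[rule_format, OF x]
        bounds(2)[rule_format, OF x] bounds(3)[rule_format, OF x] by (simp add: algebra_simps)
    finally show "cmod (k x - h x - 2 * q x) \<le> (a + b + 2 * c) * vnorm Z x" .
  qed (simp_all add: bounded_functional_vadd[OF k_functional] bounded_functional_vscale[OF k_functional]
      bounded_functional_vadd[OF h_functional] bounded_functional_vscale[OF h_functional]
      bounded_functional_vadd[OF q_functional] bounded_functional_vscale[OF q_functional] algebra_simps)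
qed

end

lemma (in banach_bimodule) dual_bound:
  assumes f: "f \<in> points (dual_bimodule Z)" and y: "y \<in> points Z"
  shows "cmod (f y) \<le> vnorm (dual_bimodule Z) f * vnorm Z y"
proof -
  have scale: "\<And>c x. x \<in> points Z \<Longrightarrow> f (vscale Z c x) = c * f x"
    and "\<exists>C. \<forall>x\<in>points Z. cmod (f x) \<le> C * vnorm Z x"
    using f by (simp_all add: dual_bimodule_def)
  then obtain C where C: "\<And>x. x \<in> points Z \<Longrightarrow> cmod (f x) \<le> C * vnorm Z x" by blast
  have bdd: "bdd_above ((\<lambda>x. cmod (f x)) ` {x \<in> points Z. vnorm Z x \<le> 1})"
  proof (rule bdd_aboveI2)
    fix x assume x: "x \<in> {x \<in> points Z. vnorm Z x \<le> 1}"
    have "cmod (f x) \<le> \<bar>C\<bar> * vnorm Z x"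
      by (rule order_trans[OF C mult_right_mono]) (use x in \<open>auto simp: vnorm_nonneg\<close>)
    also have "\<dots> \<le> \<bar>C\<bar> * 1" by (rule mult_left_mono) (use x in auto)
    finally show "cmod (f x) \<le> \<bar>C\<bar>" by simp
  qed
  show ?thesis
  proof (cases "vnorm Z y = 0")
    case True
    then show ?thesis using C[OF y] by simp
  next
    case False
    then have pos: "0 < vnorm Z y" using vnorm_nonneg[OF y] by simp
    define z where "z = vscale Z (1 / complex_of_real (vnorm Z y)) y"
    have "z \<in> points Z" "vnorm Z z = 1"
      using y pos by (simp_all add: z_def vscale_closed vnorm_vscale norm_divide)
    then have "cmod (f z) \<le> vnorm (dual_bimodule Z) f"
      unfolding dual_bimodule_def by simp (intro cSUP_upper bdd, simp)
    then show ?thesis using pos y by (simp add: z_def scale norm_divide field_simps)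
  qed
qed

text \<open>
  In the model case, amenability passes from an algebra to a left ideal with a bounded two-sided
  approximate identity, because an algebra is amenable if and only if its opposite algebra is.
\<close>

theorem amenable_of_multiplier_action:
  fixes act :: "'a::complex_banach_algebra \<Rightarrow> 'b::complex_banach_algebra \<Rightarrow> 'b"
    and e :: "'i \<Rightarrow> 'b"
  assumes act: "multiplier_action act C"
    and am: "amenable_on TYPE('a test_points) TYPE('a)"
    and bai: "bounded_approximate_identity e F"
  shows "amenable_on TYPE('w) TYPE('b)"
  unfolding amenable_on_def
proof (intro allI impI)
  fix Z :: "('b, 'w) bimodule" and D
  assume Z: "banach_bimodule Z" and D: "continuous_derivation (dual_bimodule Z) D"
  interpret banach_bimodule Z by (rule Z)
  interpret multiplier_action act C by (rule act)
  obtain M :: "'a unital_forms dual" where M: "\<And>a \<psi>. cblinfun_apply (cblinfun_apply \<psi> (0, 1)) a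
      = cblinfun_apply M (form_ract \<psi> a) - cblinfun_apply M (form_lact a \<psi>)"
    using am by (rule amenable_universal_functional) blast
  have F: "F \<noteq> bot" and e: "\<And>T. ((\<lambda>i. e i * T) \<longlongrightarrow> T) F" "\<And>T. ((\<lambda>i. T * e i) \<longlongrightarrow> T) F"
    using bai by (auto simp: bounded_approximate_identity_def)
  obtain E where E: "\<And>i. norm (e i) \<le> E"
    using bai by (auto simp: bounded_approximate_identity_def)
  obtain Lm where Lm: "generalized_limit F Lm" using F by (rule generalized_limit_exists)
  obtain B where B: "\<And>a x. x \<in> points Z \<Longrightarrow> vnorm Z (lact Z a x) \<le> B * norm a * vnorm Z x"
    using lact_bounded by blast
  obtain K where K: "\<And>T. vnorm (dual_bimodule Z) (D T) \<le> K * norm T"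
    using D by (auto simp: continuous_derivation_def)
  have pts: "D T \<in> points (dual_bimodule Z)" for T using D by (simp add: continuous_derivation_def)
  have D_eqs: "D (S + T) = vadd (dual_bimodule Z) (D S) (D T)"
    "D (c *\<^sub>C T) = vscale (dual_bimodule Z) c (D T)"
    "D (S * T) = vadd (dual_bimodule Z) (lact (dual_bimodule Z) S (D T)) (ract (dual_bimodule Z) (D S) T)"
    for S T c using D by (auto simp: continuous_derivation_def)
  have "generalized_limit F Lm" by (rule Lm)
  then interpret derivation_data Z act C F Lm D "\<bar>K\<bar>" "\<bar>B\<bar>" E e M
  proof (intro derivation_data.intro Z act derivation_data_axioms.intro)
    fix x y S T c i
    show "D T (vadd Z x y) = D T x + D T y" if "x \<in> points Z" "y \<in> points Z"
      using pts[of T] that by (simp add: dual_bimodule_def)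
    show "D T (vscale Z c y) = c * D T y" if "y \<in> points Z"
      using pts[of T] that by (simp add: dual_bimodule_def)
    show "cmod (D T y) \<le> \<bar>K\<bar> * norm T * vnorm Z y" if y: "y \<in> points Z"
    proof (rule order_trans[OF dual_bound[OF pts y] mult_right_mono])
      show "vnorm (dual_bimodule Z) (D T) \<le> \<bar>K\<bar> * norm T"
        by (rule order_trans[OF K mult_right_mono]) auto
    qed (rule vnorm_nonneg[OF y])
    show "vnorm Z (lact Z T y) \<le> \<bar>B\<bar> * norm T * vnorm Z y" if y: "y \<in> points Z"
      by (rule order_trans[OF B[OF y]]) (intro mult_right_mono, auto simp: vnorm_nonneg y)
  qed (use D_eqs E e M in \<open>auto simp: dual_bimodule_def\<close>)
  obtain f where f: "bounded_functional Z f"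
    "\<And>T y. y \<in> points Z \<Longrightarrow> D T y = f (ract Z y T) - f (lact Z T y)"
    using d_inner by blast
  show "inner_derivation (dual_bimodule Z) D"
    unfolding inner_derivation_def
  proof (intro bexI allI)
    show "restrict f (points Z) \<in> points (dual_bimodule Z)"
      using f(1) closed by (auto simp: dual_bimodule_def bounded_functional_def)
    fix T
    have "D T \<in> extensional (points Z)" using pts[of T] by (simp add: dual_bimodule_def)
    then show "D T = vdiff (dual_bimodule Z) (lact (dual_bimodule Z) T (restrict f (points Z)))
        (ract (dual_bimodule Z) (restrict f (points Z)) T)"
      by (rule extensionalityI[where A = "points Z"])
        (auto simp: vdiff_def dual_bimodule_def closed f(2))
  qed
qed

section \<open>Compact operators on the dual space\<close>

lemma compact_op_eqI:
  fixes V W :: "'x::complex_banach compact_op"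
  assumes "\<And>f :: 'x dual. cblinfun_compose f (Rep_compact_op V) = cblinfun_compose f (Rep_compact_op W)"
  shows "V = W"
proof -
  have "cblinfun_apply (Rep_compact_op V) x = cblinfun_apply (Rep_compact_op W) x" for x
  proof (rule functionals_separate)
    fix f :: "'x dual"
    show "cblinfun_apply f (cblinfun_apply (Rep_compact_op V) x)
        = cblinfun_apply f (cblinfun_apply (Rep_compact_op W) x)"
      using arg_cong[OF assms[of f], of "\<lambda>g. cblinfun_apply g x"] by simp
  qed
  then have "Rep_compact_op V = Rep_compact_op W" by (rule cblinfun_eqI)
  then show ?thesis by (simp add: Rep_compact_op_inject)
qed

text \<open>The operator on \<open>X\<close> whose adjoint is \<open>S T*\<close>.\<close>

definition predual_compose :: "'x::complex_banach dual compact_op \<Rightarrow> 'x compact_op \<Rightarrow> 'x compact_op"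
  where "predual_compose S T = (SOME V. norm V \<le> norm S * norm T \<and>
    (\<forall>f :: 'x dual. cblinfun_compose f (Rep_compact_op V)
      = cblinfun_apply (Rep_compact_op S) (cblinfun_compose f (Rep_compact_op T))))"

lemma predual_compose:
  fixes S :: "'x::complex_banach dual compact_op" and T :: "'x compact_op"
  shows norm_predual_compose: "norm (predual_compose S T) \<le> norm S * norm T"
    and predual_compose_adjoint: "cblinfun_compose f (Rep_compact_op (predual_compose S T))
      = cblinfun_apply (Rep_compact_op S) (cblinfun_compose f (Rep_compact_op T))"
proof -
  have "compact_operator (Rep_compact_op T)" using Rep_compact_op[of T] by simp
  then obtain V :: "('x, 'x) cblinfun" where "compact_operator V"
    "norm V \<le> norm (Rep_compact_op S) * norm (Rep_compact_op T)"
    "\<And>f :: 'x dual. cblinfun_compose f V = cblinfun_apply (Rep_compact_op S) (cblinfun_compose f (Rep_compact_op T))"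
    by (rule compose_adjoint_compact[where S = "Rep_compact_op S"]) blast
  then have "\<exists>V. norm V \<le> norm S * norm T \<and> (\<forall>f :: 'x dual. cblinfun_compose f (Rep_compact_op V)
      = cblinfun_apply (Rep_compact_op S) (cblinfun_compose f (Rep_compact_op T)))"
    by (intro exI[of _ "Abs_compact_op V"]) (simp add: norm_compact_op.rep_eq Abs_compact_op_inverse)
  note * = someI_ex[OF this, folded predual_compose_def]
  show "norm (predual_compose S T) \<le> norm S * norm T" using * by (rule conjunct1)
  show "cblinfun_compose f (Rep_compact_op (predual_compose S T))
      = cblinfun_apply (Rep_compact_op S) (cblinfun_compose f (Rep_compact_op T))"
    using * by (rule conjunct2[THEN spec])
qed

lemma multiplier_action_predual_compose:
  "multiplier_action (predual_compose :: 'x::complex_banach dual compact_op \<Rightarrow> _) 1"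
proof
  fix S S' :: "'x dual compact_op" and R R' T :: "'x compact_op" and c
  note [simp] = predual_compose_adjoint plus_compact_op.rep_eq scaleC_compact_op.rep_eq
    times_compact_op.rep_eq cblinfun_compose_add_left cblinfun_compose_add_right
    cblinfun_compose_scaleC_left cblinfun_compose_scaleC_right
  show "predual_compose (S + S') R = predual_compose S R + predual_compose S' R"
    by (rule compact_op_eqI) simp
  show "predual_compose (c *\<^sub>C S) R = c *\<^sub>C predual_compose S R"
    by (rule compact_op_eqI) simp
  show "predual_compose S (R + R') = predual_compose S R + predual_compose S R'"
    by (rule compact_op_eqI) simp
  show "predual_compose S (c *\<^sub>C R) = c *\<^sub>C predual_compose S R"
    by (rule compact_op_eqI) simp
  show "predual_compose (S * S') R = predual_compose S (predual_compose S' R)"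
    by (rule compact_op_eqI) simp
  show "predual_compose S (T * R) = T * predual_compose S R"
    by (rule compact_op_eqI) (simp flip: cblinfun_compose_assoc)
  show "norm (predual_compose S R) \<le> 1 * norm S * norm R"
    using norm_predual_compose[of S R] by simp
  have "compact_operator (adjoint (Rep_compact_op T))"
    using Rep_compact_op[of T] by (simp add: compact_operator_adjoint)
  then have "predual_compose (Abs_compact_op (adjoint (Rep_compact_op T))) R = R * T" for R
    by (intro compact_op_eqI) (simp add: Abs_compact_op_inverse adjoint_apply cblinfun_compose_assoc)
  then show "\<exists>S. \<forall>R. predual_compose S R = R * T" by blast
qed

theorem corollary5p2:
  fixes e :: "'i \<Rightarrow> 'x::complex_banach compact_op" and F :: "'i filter"
  assumes "infinite_dimensional TYPE('x)"
    and "amenable_on TYPE('x dual compact_op test_points) TYPE('x dual compact_op)"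
    and "bounded_approximate_identity e F"
  shows "amenable_on TYPE('w) TYPE('x compact_op)"
  using multiplier_action_predual_compose assms(2,3) by (rule amenable_of_multiplier_action)

end
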